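(* Let $r\ge 2$ be an integer, put $m=3\cdot 2^r$, and let $s\ge 1$ be an integer. Then the sequence \[ \bigl(\operatorname{odd}(t_m(n))\bmod 2^s\bigr)_{n\ge 0} \] is $2$-automatic.
   Context: Let $T(x)=\prod_{j\ge 0}(1-x^{2^j})\in\mathbb Z[[x]]$ be the Thue--Morse generating function, and for each integer $m\ge 1$ define the integers $t_m(n)$ by $T(x)^m=\sum_{n\ge 0}t_m(n)x^n$. For a nonzero integer $a$, $\nu_2(a)$ is the largest integer $v$ such that $2^v$ divides $a$. The signed odd part is $\operatorname{odd}(a)=a/2^{\nu_2(a)}$ for $a\neq 0$ and $\operatorname{odd}(0)=0$. A sequence $(a_n)_{n\ge 0}$ with values in a finite set is $2$-automatic if there is a finite automaton which, reading the binary expansion of $n$ from the most significant digit, outputs $a_n$; equivalently, its $2$-kernel $\{(a_{2^e n+c})_{n\ge 0}: e\ge 0,\ 0\le c<2^e\}$ is finite. *)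

theory Defs
  imports "HOL-Analysis.Analysis" "HOL-Computational_Algebra.Computational_Algebra"
begin

unbundle fps_syntax

text \<open>
  The infinite product is the library's \<^const>\<open>prodinf\<close>, taken in the formal (\<open>x\<close>-adic) topology
  of \<open>int fps\<close>. As \<^const>\<open>prodinf\<close> is total, its convergence is recorded separately below.
\<close>
definition thue_morse_fps :: "int fps" where
  "thue_morse_fps = (\<Prod>j. 1 - fps_X ^ (2 ^ j))"

lemma thue_morse_fps_has_prod: "(\<lambda>j. 1 - fps_X ^ (2 ^ j)) has_prod thue_morse_fps"
proof -
  let ?f = "\<lambda>j. 1 - fps_X ^ (2 ^ j) :: int fps"
  have nth0: "?f j $ 0 = 1" for j
    by (simp add: fps_X_power_nth)
  have nz: "?f j \<noteq> 0" for j
    using nth0[of j] by (metis fps_zero_nth zero_neq_one)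
  have sub: "subdegree (?f j - 1) > n" if "j > n" for n j :: nat
  proof -
    have "?f j - 1 = - (fps_X ^ (2 ^ j))" by simp
    hence "subdegree (?f j - 1) = 2 ^ j" by (simp only: subdegree_uminus fps_X_power_subdegree)
    thus ?thesis using that less_exp[of j] by linarith
  qed
  obtain P where P: "(\<lambda>n. \<Prod>k\<le>n. ?f k) \<longlonglongrightarrow> P"
    using tendsto_prod_fps[of ?f "\<lambda>n. n", OF nz sub] by blast
  have one: "(\<Prod>k\<le>n. ?f k) $ 0 = 1" for n
    by (induction n) (simp_all add: nth0)
  have "eventually (\<lambda>n. (\<Prod>k\<le>n. ?f k) $ 0 = P $ 0) sequentially"
    using P unfolding tendsto_fps_iff by blast
  then obtain n where "(\<Prod>k\<le>n. ?f k) $ 0 = P $ 0"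
    by (auto simp: eventually_sequentially)
  hence "P \<noteq> 0" using one[of n] by auto
  hence "?f has_prod P"
    using P by (simp add: has_prod_def raw_has_prod_def)
  thus ?thesis
    unfolding thue_morse_fps_def using has_prod_unique[of ?f P] by simp
qed

definition thue_morse_power_coeff :: "nat \<Rightarrow> nat \<Rightarrow> int" where
  "thue_morse_power_coeff m n = (thue_morse_fps ^ m) $ n"

definition signed_odd_part :: "int \<Rightarrow> int" where
  "signed_odd_part a = (if a = 0 then 0 else a div 2 ^ multiplicity 2 a)"

text \<open>
  Binary expansion, most significant digit first, without leading zeros;
  the expansion of 0 is the empty word.
\<close>
fun binary_expansion :: "nat \<Rightarrow> nat list" where
  "binary_expansion n = (if n = 0 then [] else binary_expansion (n div 2) @ [n mod 2])"

declare binary_expansion.simps [simp del]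

text \<open>
  A deterministic finite automaton with output: state set \<open>Q\<close>, initial state \<open>q0\<close>,
  transition function \<open>\<delta>\<close>, output function \<open>\<tau>\<close>. Taking the states to be natural numbers is no
  restriction. The sequence takes values in the finite set \<open>\<tau> ` Q\<close>.
\<close>
definition two_automatic :: "(nat \<Rightarrow> 'a) \<Rightarrow> bool" where
  "two_automatic a \<longleftrightarrow>
     (\<exists>(Q :: nat set) q0 \<delta> \<tau>.
        finite Q \<and> q0 \<in> Q \<and>
        (\<forall>q\<in>Q. \<forall>d\<in>{0, 1 :: nat}. \<delta> q d \<in> Q) \<and>
        (\<forall>n. a n = \<tau> (foldl \<delta> q0 (binary_expansion n))))"

end

theory Submission
  imports Defs
begin

text \<open>
  Let \<open>m = 3 \<sqdot> 2\<^sup>r\<close>, \<open>M = m - 1\<close>, \<open>f = T\<^sup>m\<close> and let \<open>S\<^sub>i(N)\<close> be the coefficient of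
  \<open>x\<^sup>N\<close> in \<open>x\<^sup>i (1 - x)\<^bsup>M-i\<^esup> f\<close>. Since \<open>f \<equiv> (1 - x)\<^bsup>-m\<^esup>\<close> modulo \<open>2\<^bsup>r+1\<^esup>\<close>, the
  coefficient \<open>t(n)\<close> has valuation at most \<open>r\<close> unless \<open>2\<^bsup>r+2\<^esup>\<close> divides \<open>n + c\<close> for some
  \<open>1 \<le> c \<le> M\<close>; in the bounded case the odd part is determined by \<open>t(n)\<close> modulo a fixed power of 2.

  In the remaining case write \<open>n + c = 2\<^sup>k N\<close> with \<open>N\<close> odd. The functional equation of \<open>f\<close> gives
  \<open>S\<^sub>i(2N) = \<Sum>\<^sub>j c\<^sub>i\<^sub>j S\<^sub>j(N)\<close> with explicit binomial \<open>c\<^sub>i\<^sub>j\<close>, and on the lattice spanned by the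
  \<open>2\<^bsup>v(i)\<^esup> S\<^sub>i\<close> (\<open>v\<close> the 2-adic valuation) this transformation is twice an integer matrix \<open>A\<close>. Hence
  \<open>c (M choose c) t(n) = 2\<^sup>k y\<close>, where \<open>y\<close> is the pairing of the \<open>k\<close>-th iterate of a weight vector
  under \<open>A\<close> with the vector \<open>2\<^bsup>v(i)\<^esup> S\<^sub>i(N)\<close>. Modulo 2 the matrix moves the index \<open>i\<close> to
  \<open>\<lceil>i/2\<rceil>\<close>, except that \<open>i = 2\<^bsup>r+1\<^esup> - 1\<close> is annihilated, so after many steps only \<open>S\<^sub>1\<close> survives
  and \<open>y \<equiv> S\<^sub>1(N) \<equiv> N \<equiv> 1\<close>. So \<open>y\<close> is a fixed multiple of the odd part of \<open>t(n)\<close>; modulo \<open>2\<^sup>s\<close>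
  it only depends on the iterate, which is eventually periodic in \<open>k\<close>, and on residues of
  \<open>t(N), \<dots>, t(N - M)\<close>, which a finite automaton can compute.
\<close>

subsection \<open>Automata as congruences on the natural numbers\<close>

text \<open>
  The values of \<open>\<Phi>\<close> serve as states: \<open>\<Phi> n\<close> is the state reached after reading \<open>n\<close>, and the
  condition says that appending a digit is a well-defined transition.
\<close>
definition digit_congruent :: "(nat \<Rightarrow> 'b) \<Rightarrow> bool" where
  "digit_congruent \<Phi> \<longleftrightarrow> finite (range \<Phi>) \<and>
     (\<forall>n n'. \<Phi> n = \<Phi> n' \<longrightarrow> \<Phi> (2 * n) = \<Phi> (2 * n') \<and> \<Phi> (Suc (2 * n)) = \<Phi> (Suc (2 * n')))"

lemma digit_congruent_finite: "digit_congruent \<Phi> \<Longrightarrow> finite (range \<Phi>)"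
  by (simp add: digit_congruent_def)

lemma digit_congruentI:
  assumes "finite (range \<Phi>)"
    and "\<And>n n'. \<Phi> n = \<Phi> n' \<Longrightarrow> \<Phi> (2 * n) = \<Phi> (2 * n')"
    and "\<And>n n'. \<Phi> n = \<Phi> n' \<Longrightarrow> \<Phi> (Suc (2 * n)) = \<Phi> (Suc (2 * n'))"
  shows "digit_congruent \<Phi>"
  unfolding digit_congruent_def by (intro conjI allI impI assms)

lemma digit_congruent_even:
  assumes "digit_congruent \<Phi>" "\<Phi> n = \<Phi> n'"
  shows "\<Phi> (2 * n) = \<Phi> (2 * n')"
  using assms(1)[unfolded digit_congruent_def] assms(2) by (elim conjE allE impE) assumption+

lemma digit_congruent_odd:
  assumes "digit_congruent \<Phi>" "\<Phi> n = \<Phi> n'"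
  shows "\<Phi> (Suc (2 * n)) = \<Phi> (Suc (2 * n'))"
  using assms(1)[unfolded digit_congruent_def] assms(2) by (elim conjE allE impE) assumption+

lemma digit_congruentD:
  assumes "digit_congruent \<Phi>" "\<Phi> n = \<Phi> n'" "b < 2"
  shows "\<Phi> (2 * n + b) = \<Phi> (2 * n' + b)"
proof -
  have "b = 0 \<or> b = 1" using assms(3) by auto
  thus ?thesis
    using digit_congruent_even[OF assms(1,2)] digit_congruent_odd[OF assms(1,2)] by auto
qed

lemma two_automatic_if_digit_congruent:
  assumes \<Phi>: "digit_congruent \<Phi>" and a: "\<And>n n'. \<Phi> n = \<Phi> n' \<Longrightarrow> a n = a n'"
  shows "two_automatic a"
proof -
  obtain e :: "'a \<Rightarrow> nat" where e: "inj_on e (range \<Phi>)"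
    using finite_imp_inj_to_nat_seg[OF digit_congruent_finite[OF \<Phi>]] by blast
  \<comment> \<open>States are codes of values of \<Phi>; \<open>\<rho>\<close> picks a number
    reaching a given state, and the congruence makes the choice immaterial.\<close>
  define \<rho> where "\<rho> q = (SOME n. e (\<Phi> n) = q)" for q
  have rep: "\<Phi> (\<rho> (e (\<Phi> n))) = \<Phi> n" for n
  proof -
    have "e (\<Phi> (\<rho> (e (\<Phi> n)))) = e (\<Phi> n)"
      unfolding \<rho>_def by (rule someI[of _ n]) simp
    thus ?thesis using e by (auto dest: inj_onD)
  qed
  define \<delta> where "\<delta> q d = e (\<Phi> (2 * \<rho> q + d))" for q d
  have step: "\<delta> (e (\<Phi> n)) b = e (\<Phi> (2 * n + b))" if "b < 2" for n b
    unfolding \<delta>_def using digit_congruentD[OF \<Phi> rep that] by simp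
  have run: "foldl \<delta> (e (\<Phi> 0)) (binary_expansion n) = e (\<Phi> n)" for n
  proof (induction n rule: less_induct)
    case (less n)
    show ?case
    proof (cases "n = 0")
      case True
      thus ?thesis by (simp add: binary_expansion.simps)
    next
      case False
      hence "foldl \<delta> (e (\<Phi> 0)) (binary_expansion n) = \<delta> (e (\<Phi> (n div 2))) (n mod 2)"
        using less.IH[of "n div 2"] by (subst binary_expansion.simps) simp
      thus ?thesis by (simp add: step)
    qed
  qed
  show ?thesis unfolding two_automatic_def
  proof (intro exI conjI)
    show "finite (range (e \<circ> \<Phi>))"
      using digit_congruent_finite[OF \<Phi>] by (metis finite_imageI image_comp)
    show "e (\<Phi> 0) \<in> range (e \<circ> \<Phi>)" by auto
    show "\<forall>q\<in>range (e \<circ> \<Phi>). \<forall>d\<in>{0, 1}. \<delta> q d \<in> range (e \<circ> \<Phi>)"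
      by (auto simp: \<delta>_def)
    show "\<forall>n. a n = (a \<circ> \<rho>) (foldl \<delta> (e (\<Phi> 0)) (binary_expansion n))"
      using a rep by (metis comp_apply run)
  qed
qed

lemma digit_congruent_Pair:
  assumes "digit_congruent \<Phi>" "digit_congruent \<Psi>"
  shows "digit_congruent (\<lambda>n. (\<Phi> n, \<Psi> n))"
proof -
  have "range (\<lambda>n. (\<Phi> n, \<Psi> n)) \<subseteq> range \<Phi> \<times> range \<Psi>" by auto
  hence "finite (range (\<lambda>n. (\<Phi> n, \<Psi> n)))"
    by (rule finite_subset) (intro finite_cartesian_product digit_congruent_finite assms)
  thus ?thesis
  proof (rule digit_congruentI)
    fix n n' assume "(\<Phi> n, \<Psi> n) = (\<Phi> n', \<Psi> n')"
    hence *: "\<Phi> n = \<Phi> n'" "\<Psi> n = \<Psi> n'" by simp_all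
    show "(\<Phi> (2 * n), \<Psi> (2 * n)) = (\<Phi> (2 * n'), \<Psi> (2 * n'))"
      using digit_congruent_even[OF assms(1) *(1)] digit_congruent_even[OF assms(2) *(2)] by simp
    show "(\<Phi> (Suc (2 * n)), \<Psi> (Suc (2 * n))) = (\<Phi> (Suc (2 * n')), \<Psi> (Suc (2 * n')))"
      using digit_congruent_odd[OF assms(1) *(1)] digit_congruent_odd[OF assms(2) *(2)] by simp
  qed
qed

lemma digit_congruent_mod: "digit_congruent (\<lambda>n. n mod k)" if "k > 0" for k :: nat
proof -
  have "finite (range (\<lambda>n. n mod k))"
    by (rule finite_subset[of _ "{..<k}"]) (use that in auto)
  moreover have "(2 * n) mod k = (2 * n') mod k" "Suc (2 * n) mod k = Suc (2 * n') mod k"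
    if "n mod k = n' mod k" for n n'
  proof -
    show *: "(2 * n) mod k = (2 * n') mod k" using that by (metis mod_mult_right_eq)
    show "Suc (2 * n) mod k = Suc (2 * n') mod k" using * by (metis mod_Suc_eq)
  qed
  ultimately show ?thesis
    by (intro digit_congruentI)
qed

text \<open>Since \<open>2 * n + d = 2 * (n + d div 2) + d mod 2\<close>, the window of shifts is
  closed under appending a digit: offsets reach \<open>L + 1\<close>, and their halves stay within
  \<open>L\<close> because \<open>L > 0\<close>.\<close>

lemma digit_congruent_shifts:
  assumes \<Phi>: "digit_congruent \<Phi>" and "L > 0"
  shows "digit_congruent (\<lambda>n. map (\<lambda>c. \<Phi> (n + c)) [0..<Suc L])"
proof -
  let ?\<Psi> = "\<lambda>n. map (\<lambda>c. \<Phi> (n + c)) [0..<Suc L]"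
  have "range ?\<Psi> \<subseteq> {xs. set xs \<subseteq> range \<Phi> \<and> length xs = Suc L}" by auto
  hence fin: "finite (range ?\<Psi>)"
    by (rule finite_subset) (intro finite_lists_length_eq digit_congruent_finite[OF \<Phi>])
  have eq: "\<Phi> (2 * n + d) = \<Phi> (2 * n' + d)" if n: "?\<Psi> n = ?\<Psi> n'" and d: "d \<le> Suc L" for n n' d
  proof -
    have "d div 2 \<le> L" using d \<open>L > 0\<close> by linarith
    hence "\<Phi> (n + d div 2) = \<Phi> (n' + d div 2)"
      using n by (auto simp del: upt_Suc)
    hence "\<Phi> (2 * (n + d div 2) + d mod 2) = \<Phi> (2 * (n' + d div 2) + d mod 2)"
      by (intro digit_congruentD[OF \<Phi>]) auto
    thus ?thesis by (simp add: algebra_simps)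
  qed
  show ?thesis
  proof (rule digit_congruentI[OF fin])
    fix n n' assume *: "?\<Psi> n = ?\<Psi> n'"
    have "\<Phi> (2 * n + c) = \<Phi> (2 * n' + c)" "\<Phi> (2 * n + Suc c) = \<Phi> (2 * n' + Suc c)" if "c < Suc L" for c
      using eq[OF *, of c] eq[OF *, of "Suc c"] that by auto
    thus "?\<Psi> (2 * n) = ?\<Psi> (2 * n')" "?\<Psi> (Suc (2 * n)) = ?\<Psi> (Suc (2 * n'))"
      by (auto simp del: upt_Suc)
  qed
qed

lemma multiplicity_2_double: "n > 0 \<Longrightarrow> multiplicity 2 (2 * n) = Suc (multiplicity 2 n)" for n :: nat
  by (rule multiplicity_times_same) auto

text \<open>Appending 0 keeps the odd part and raises the exponent by one; appending 1 gives an odd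
  number, its own odd part, with exponent 0, so \<open>\<Phi> n\<close> is stored too.
  \<open>None\<close> isolates 0, whose multiplicity does not grow under doubling.\<close>

lemma digit_congruent_odd_part:
  assumes \<Phi>: "digit_congruent \<Phi>"
    and fin: "finite (range \<alpha>)" and \<alpha>: "\<And>k k'. \<alpha> k = \<alpha> k' \<Longrightarrow> \<alpha> (Suc k) = \<alpha> (Suc k')"
  shows "digit_congruent (\<lambda>n. (\<Phi> n,
           if n = 0 then None else Some (\<Phi> (n div 2 ^ multiplicity 2 n), \<alpha> (multiplicity 2 n))))"
    (is "digit_congruent ?\<Psi>")
proof -
  have "range ?\<Psi> \<subseteq> range \<Phi> \<times> insert None (Some ` (range \<Phi> \<times> range \<alpha>))"
  proof (rule image_subsetI)
    show "?\<Psi> n \<in> range \<Phi> \<times> insert None (Some ` (range \<Phi> \<times> range \<alpha>))" for n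
      by (cases "n = 0") simp_all
  qed
  hence fin': "finite (range ?\<Psi>)"
    by (rule finite_subset) (use fin digit_congruent_finite[OF \<Phi>] in simp)
  have odd: "multiplicity 2 (Suc (2 * k)) = 0" for k :: nat
    by (rule not_dvd_imp_multiplicity_0) simp
  show ?thesis
  proof (rule digit_congruentI[OF fin'])
    fix n n' assume eq: "?\<Psi> n = ?\<Psi> n'"
    hence eq': "\<Phi> n = \<Phi> n'" by simp
    show "?\<Psi> (2 * n) = ?\<Psi> (2 * n')"
      using eq \<alpha>[of "multiplicity 2 n" "multiplicity 2 n'"] digit_congruent_even[OF \<Phi> eq']
      by (cases "n = 0"; cases "n' = 0") (simp_all add: multiplicity_2_double)
    show "?\<Psi> (Suc (2 * n)) = ?\<Psi> (Suc (2 * n'))"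
      using digit_congruent_odd[OF \<Phi> eq'] by (simp add: odd del: mult_Suc_right)
  qed
qed

section \<open>Coefficients of \<open>P(x) g(x^2)\<close> at indices of given parity\<close>

lemma fps_double_argument_nth:
  fixes P g :: "int fps"
  assumes P: "\<And>l. l \<ge> 2 * d \<Longrightarrow> P $ l = 0" and b: "b < 2"
  shows "(P * (g oo fps_X ^ 2)) $ (2 * n + b) = (\<Sum>i<d. P $ (2 * i + b) * (fps_X ^ i * g) $ n)"
proof -
  have "(P * (g oo fps_X ^ 2)) $ (2 * n + b)
      = (\<Sum>l\<le>2 * n + b. P $ l * (if even (2 * n + b - l) then g $ ((2 * n + b - l) div 2) else 0))"
    by (simp add: fps_mult_nth fps_nth_compose_X_power atLeast0AtMost)
  also have "\<dots> = (\<Sum>i\<le>n. P $ (2 * i + b) * g $ (n - i))"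
  proof -
    let ?h = "\<lambda>l. P $ l * (if even (2 * n + b - l) then g $ ((2 * n + b - l) div 2) else 0)"
    have "(\<Sum>l\<le>2 * n + b. ?h l) = (\<Sum>l\<in>(\<lambda>i. 2 * i + b) ` {..n}. ?h l)"
    proof (intro sum.mono_neutral_right ballI)
      fix l assume l: "l \<in> {..2 * n + b} - (\<lambda>i. 2 * i + b) ` {..n}"
      have "odd (2 * n + b - l)"
      proof
        assume "even (2 * n + b - l)"
        then obtain k where k: "2 * n + b - l = 2 * k" by blast
        show False
        proof (cases "k \<le> n")
          case True
          hence "l = 2 * (n - k) + b" using k l by auto
          thus False using l by auto
        next
          case False
          thus False using k b by linarith
        qed
      qed
      thus "?h l = 0" by simp
    qed auto
    also have "\<dots> = (\<Sum>i\<le>n. ?h (2 * i + b))"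
      by (subst sum.reindex) (auto simp: inj_on_def)
    also have "\<dots> = (\<Sum>i\<le>n. P $ (2 * i + b) * g $ (n - i))"
    proof (rule sum.cong[OF refl])
      fix i assume "i \<in> {..n}"
      hence "2 * n + b - (2 * i + b) = 2 * (n - i)" by auto
      thus "?h (2 * i + b) = P $ (2 * i + b) * g $ (n - i)" by simp
    qed
    finally show ?thesis .
  qed
  also have "\<dots> = (\<Sum>i<d. P $ (2 * i + b) * (fps_X ^ i * g) $ n)"
    by (intro sum.mono_neutral_cong) (auto simp: fps_X_power_mult_nth P)
  finally show ?thesis .
qed

subsection \<open>The functional equation\<close>

text \<open>The partial products satisfy the equation up to an index shift, and their coefficients
  are eventually constant. One \<open>N\<close> serves all coefficients up to \<open>n\<close>,
  which is all that coefficient \<open>n\<close> of the right-hand side involves.\<close>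

lemma thue_morse_fps_rec: "thue_morse_fps = (1 - fps_X) * (thue_morse_fps oo fps_X ^ 2)"
proof (rule fps_ext)
  fix n
  let ?P = "\<lambda>N. \<Prod>k\<le>N. 1 - fps_X ^ (2 ^ k) :: int fps"
  have rec: "?P (Suc N) = (1 - fps_X) * (?P N oo fps_X ^ 2)" for N
    by (simp add: prod.atMost_Suc_shift fps_compose_prod_distrib fps_compose_sub_distrib
        fps_compose_power[symmetric] power_mult[symmetric] del: prod.atMost_Suc)
  have lim: "eventually (\<lambda>N. ?P N $ k = thue_morse_fps $ k) sequentially" for k
    using has_prod_imp_tendsto[OF thue_morse_fps_has_prod] by (simp add: tendsto_fps_iff)
  have "eventually (\<lambda>N. ?P (Suc N) $ n = thue_morse_fps $ n) sequentially"
    using iffD2[OF eventually_sequentially_Suc[of "\<lambda>N. ?P N $ n = thue_morse_fps $ n"] lim[of n]] .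
  moreover have "eventually (\<lambda>N. \<forall>k\<in>{..n}. ?P N $ k = thue_morse_fps $ k) sequentially"
    using lim by (simp add: eventually_ball_finite)
  ultimately have "eventually (\<lambda>N. ?P (Suc N) $ n = thue_morse_fps $ n \<and>
      (\<forall>k\<in>{..n}. ?P N $ k = thue_morse_fps $ k)) sequentially"
    by (rule eventually_conj)
  then obtain N where N: "?P (Suc N) $ n = thue_morse_fps $ n"
      "\<And>k. k \<le> n \<Longrightarrow> ?P N $ k = thue_morse_fps $ k"
    by (auto simp: eventually_sequentially)
  have "thue_morse_fps $ n = ((1 - fps_X) * (?P N oo fps_X ^ 2)) $ n"
    using N(1) rec by metis
  also have "\<dots> = ((1 - fps_X) * (thue_morse_fps oo fps_X ^ 2)) $ n"
    unfolding fps_mult_nth fps_nth_compose_X_power using N(2) by (intro sum.cong) auto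
  finally show "thue_morse_fps $ n = ((1 - fps_X) * (thue_morse_fps oo fps_X ^ 2)) $ n" .
qed

lemma thue_morse_power_rec:
  "thue_morse_fps ^ m = (1 - fps_X) ^ m * (thue_morse_fps ^ m oo fps_X ^ 2)"
  by (subst thue_morse_fps_rec) (simp add: power_mult_distrib fps_compose_power)

lemma thue_morse_fps_nth_0: "thue_morse_fps $ 0 = 1"
proof -
  have "eventually (\<lambda>N. (\<Prod>k\<le>N. 1 - fps_X ^ (2 ^ k) :: int fps) $ 0 = thue_morse_fps $ 0) sequentially"
    using has_prod_imp_tendsto[OF thue_morse_fps_has_prod] by (simp add: tendsto_fps_iff)
  moreover have "(\<Prod>k\<le>N. 1 - fps_X ^ (2 ^ k) :: int fps) $ 0 = 1" for N
    by (induction N) (simp_all add: fps_X_power_nth)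
  ultimately show ?thesis by simp
qed

text \<open>Of two consecutive coefficients of \<open>T(x^2)\<close> exactly one has even index, so
  up to sign each coefficient is an earlier one, down to the constant term 1.\<close>

lemma odd_thue_morse_fps_nth: "odd (thue_morse_fps $ n)"
proof (induction n rule: less_induct)
  case (less n)
  let ?g = "thue_morse_fps oo fps_X ^ 2"
  have "thue_morse_fps $ n = ?g $ n - (if n = 0 then 0 else ?g $ (n - 1))"
    by (subst thue_morse_fps_rec) (simp add: left_diff_distrib)
  moreover have "?g $ k = (if even k then thue_morse_fps $ (k div 2) else 0)" for k
    by (simp add: fps_nth_compose_X_power)
  ultimately show ?case
    using less.IH[of "n div 2"] less.IH[of "(n - 1) div 2"] thue_morse_fps_nth_0
    by (cases "n = 0") (auto simp: )
qed

section \<open>Congruence of \<open>T^m\<close> with \<open>(1 - x)^(-m)\<close> modulo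
  \<open>2^(r+1)\<close>\<close>

lemma power_2_power_cong_1:
  fixes V :: "int fps"
  shows "\<exists>W. (1 + 2 * V) ^ (2 ^ r) = 1 + 2 ^ Suc r * W"
proof (induction r)
  case (Suc r)
  then obtain W where W: "(1 + 2 * V) ^ (2 ^ r) = 1 + 2 ^ Suc r * W" by blast
  have "(1 + 2 * V) ^ (2 ^ Suc r) = ((1 + 2 * V) ^ (2 ^ r)) ^ 2"
    by (simp add: power_mult[symmetric] mult.commute)
  also have "\<dots> = 1 + 2 ^ Suc (Suc r) * (W + 2 ^ r * W ^ 2)"
    unfolding W by (simp add: power2_eq_square algebra_simps)
  finally show ?case by blast
qed (simp add: exI[of _ V])

text \<open>Differences of consecutive coefficients of \<open>T\<close> are even, so
  \<open>T (1 - x)\<close> is 1 modulo 2; \<open>r\<close> squarings improve the modulus to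
  \<open>2 ^ Suc r\<close>, and cubing preserves it.\<close>

lemma thue_morse_power_cong:
  "\<exists>W. thue_morse_fps ^ (3 * 2 ^ r) * (1 - fps_X) ^ (3 * 2 ^ r) = 1 + 2 ^ Suc r * W"
proof -
  let ?U = "thue_morse_fps * (1 - fps_X)"
  define V where "V = Abs_fps (\<lambda>n. (?U - 1) $ n div 2)"
  have "even ((?U - 1) $ n)" for n
    using odd_thue_morse_fps_nth[of n] odd_thue_morse_fps_nth[of "n - 1"]
    by (cases "n = 0") (simp_all add: right_diff_distrib)
  hence "?U = 1 + 2 * V"
    by (intro fps_ext) (simp add: V_def numeral_fps_const)
  then obtain W where W: "?U ^ (2 ^ r) = 1 + 2 ^ Suc r * W"
    using power_2_power_cong_1[of V r] by auto
  have "(1 + 2 ^ Suc r * W) ^ 3 = 1 + 2 ^ Suc r * (3 * W + 3 * 2 ^ Suc r * W ^ 2 + 2 ^ Suc r * 2 ^ Suc r * W ^ 3)"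
    by (simp add: power3_eq_cube power2_eq_square algebra_simps)
  moreover have "thue_morse_fps ^ (3 * 2 ^ r) * (1 - fps_X) ^ (3 * 2 ^ r) = (?U ^ (2 ^ r)) ^ 3"
    by (simp only: power_mult_distrib power_mult[symmetric] mult.commute)
  ultimately show ?thesis unfolding W by (metis)
qed

section \<open>Even-indexed coefficients of \<open>x^i (1 - x)^a g(x^2)\<close>\<close>

text \<open>Coordinates of the even part of \<open>x^i (1 - x)^(2M+1-i)\<close> in the basis
  \<open>y^j (1 - y)^(M-j)\<close>, where \<open>y = x^2\<close>.\<close>

definition section_coeff :: "nat \<Rightarrow> nat \<Rightarrow> nat \<Rightarrow> int" where
  "section_coeff M i j =
     (if i \<le> 2 * j then (- 2) ^ (2 * j - i) * int ((M + j - i) choose (2 * j - i)) else 0)"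

text \<open>Pascal's rule, except at the edge \<open>j = Suc M\<close>, where the term for
  \<open>M\<close> is absent and both remaining binomials are 1.\<close>

lemma section_coeff_step:
  assumes "i \<le> Suc (2 * M)" "j \<le> Suc M"
  shows "section_coeff (Suc M) i j =
    (if j \<le> M then section_coeff M i j else 0) - 2 * section_coeff (Suc M) (Suc i) j"
proof -
  consider "2 * j < i" | "2 * j = i" | "i < 2 * j" by linarith
  thus ?thesis
  proof cases
    case 1
    thus ?thesis by (simp add: section_coeff_def)
  next
    case 2
    thus ?thesis using assms by (auto simp: section_coeff_def)
  next
    case 3
    then obtain b where b: "2 * j = i + Suc b"
      by (metis add_Suc_right less_iff_Suc_add)
    have ge: "i \<le> M + j"
    proof (cases "j \<le> M")
      case True
      thus ?thesis using 3 by simp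
    next
      case False
      thus ?thesis using assms by simp
    qed
    show ?thesis
    proof (cases "j \<le> M")
      case True
      thus ?thesis using b ge by (simp add: section_coeff_def Suc_diff_le algebra_simps)
    next
      case False
      hence j: "j = Suc M" using assms by simp
      have eqs: "Suc M + j - i = Suc b" "2 * j - i = Suc b" "Suc M + j - Suc i = b" "2 * j - Suc i = b"
        using b j by auto
      have "section_coeff (Suc M) i j = (-2) ^ Suc b"
        using 3 unfolding section_coeff_def eqs by simp
      moreover have "section_coeff (Suc M) (Suc i) j = (-2) ^ b"
        using 3 unfolding section_coeff_def eqs by simp
      ultimately show ?thesis using False by simp
    qed
  qed
qed

lemma even_section:
  fixes g :: "int fps"
  assumes "i + a = Suc (2 * M)"
  shows "(fps_X ^ i * (1 - fps_X) ^ a * (g oo fps_X ^ 2)) $ (2 * n)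
       = (\<Sum>j\<le>M. section_coeff M i j * (fps_X ^ j * (1 - fps_X) ^ (M - j) * g) $ n)"
  using assms
  \<comment> \<open>the step rests on \<open>(1 - x)\<^sup>2 = (1 - x\<^sup>2) - 2 x (1 - x)\<close>\<close>
proof (induction a arbitrary: i M g rule: less_induct)
  case (less a)
  consider "a = 0" | "a = 1" | a' where "a = a' + 2"
    by (metis One_nat_def add_2_eq_Suc' not0_implies_Suc)
  thus ?case
  proof cases
    case 1
    have "section_coeff M i j = 0" if "j \<le> M" for j
      using less.prems 1 that by (simp add: section_coeff_def)
    thus ?thesis
      using less.prems 1 by (simp add: fps_X_power_mult_nth fps_nth_compose_X_power del: power_Suc)
  next
    case 2
    hence i: "i = 2 * M" using less.prems by simp
    have "section_coeff M i j = (if j = M then 1 else 0)" if "j \<le> M" for j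
      using i that by (simp add: section_coeff_def)
    hence "(\<Sum>j\<le>M. section_coeff M i j * (fps_X ^ j * (1 - fps_X) ^ (M - j) * g) $ n)
        = (\<Sum>j\<le>M. if j = M then (fps_X ^ M * g) $ n else 0)"
      by (intro sum.cong) auto
    also have "\<dots> = (fps_X ^ M * g) $ n" by simp
    also have "\<dots> = (fps_X ^ i * (g oo fps_X ^ 2)) $ (2 * n)"
      by (auto simp: i fps_X_power_mult_nth fps_nth_compose_X_power right_diff_distrib'[symmetric])
    \<comment> \<open>The subtracted term lives in odd degrees, so it contributes nothing at
      \<open>2 * n\<close>.\<close>
    also have "\<dots> = (fps_X ^ i * (g oo fps_X ^ 2)) $ (2 * n) - (fps_X ^ Suc i * (g oo fps_X ^ 2)) $ (2 * n)"
      by (auto simp: i fps_X_power_mult_nth fps_nth_compose_X_power simp del: power_Suc)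
    also have "\<dots> = (fps_X ^ i * (1 - fps_X) ^ a * (g oo fps_X ^ 2)) $ (2 * n)"
      by (simp add: 2 algebra_simps)
    finally show ?thesis by simp
  next
    case 3
    obtain M' where M: "M = Suc M'" using less.prems 3 by (cases M) auto
    let ?g = "g oo fps_X ^ 2"
    have comp: "((1 - fps_X) * g) oo fps_X ^ 2 = (1 - fps_X ^ 2) * ?g"
      by (simp add: fps_compose_mult_distrib fps_compose_sub_distrib)
    have "fps_X ^ i * (1 - fps_X) ^ a * ?g
        = fps_X ^ i * (1 - fps_X) ^ a' * ((1 - fps_X ^ 2) * ?g)
          - 2 * (fps_X ^ Suc i * (1 - fps_X) ^ Suc a' * ?g)"
      by (simp add: 3 power2_eq_square algebra_simps)
    hence "(fps_X ^ i * (1 - fps_X) ^ a * ?g) $ (2 * n)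
        = (fps_X ^ i * (1 - fps_X) ^ a' * ((1 - fps_X ^ 2) * ?g)) $ (2 * n)
          - 2 * (fps_X ^ Suc i * (1 - fps_X) ^ Suc a' * ?g) $ (2 * n)"
      by (simp add: numeral_fps_const del: power_Suc)
    also have "(fps_X ^ i * (1 - fps_X) ^ a' * ((1 - fps_X ^ 2) * ?g)) $ (2 * n)
        = (\<Sum>j\<le>M'. section_coeff M' i j * (fps_X ^ j * (1 - fps_X) ^ (M' - j) * ((1 - fps_X) * g)) $ n)"
      unfolding comp[symmetric] by (rule less.IH) (use 3 M less.prems in auto)
    also have "\<dots> = (\<Sum>j\<le>M'. section_coeff M' i j * (fps_X ^ j * (1 - fps_X) ^ (M - j) * g) $ n)"
      by (intro sum.cong) (simp_all add: M Suc_diff_le mult_ac)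
    also have "\<dots> = (\<Sum>j\<le>M. (if j \<le> M' then section_coeff M' i j else 0) *
        (fps_X ^ j * (1 - fps_X) ^ (M - j) * g) $ n)"
      unfolding M by simp
    also have "(fps_X ^ Suc i * (1 - fps_X) ^ Suc a' * ?g) $ (2 * n)
        = (\<Sum>j\<le>M. section_coeff M (Suc i) j * (fps_X ^ j * (1 - fps_X) ^ (M - j) * g) $ n)"
      by (rule less.IH) (use 3 M less.prems in auto)
    also have "(\<Sum>j\<le>M. (if j \<le> M' then section_coeff M' i j else 0) *
          (fps_X ^ j * (1 - fps_X) ^ (M - j) * g) $ n)
        - 2 * (\<Sum>j\<le>M. section_coeff M (Suc i) j * (fps_X ^ j * (1 - fps_X) ^ (M - j) * g) $ n)
        = (\<Sum>j\<le>M. section_coeff M i j * (fps_X ^ j * (1 - fps_X) ^ (M - j) * g) $ n)"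
      unfolding sum_distrib_left sum_subtractf[symmetric]
    proof (intro sum.cong refl)
      fix j assume "j \<in> {..M}"
      hence "section_coeff M i j
          = (if j \<le> M' then section_coeff M' i j else 0) - 2 * section_coeff M (Suc i) j"
        using section_coeff_step[of i M' j] less.prems 3 M by auto
      thus "(if j \<le> M' then section_coeff M' i j else 0) *
          (fps_X ^ j * (1 - fps_X) ^ (M - j) * g) $ n
        - 2 * (section_coeff M (Suc i) j * (fps_X ^ j * (1 - fps_X) ^ (M - j) * g) $ n)
        = section_coeff M i j * (fps_X ^ j * (1 - fps_X) ^ (M - j) * g) $ n"
        by (simp add: left_diff_distrib)
    qed
    finally show ?thesis .
  qed
qed

subsection \<open>Parity and valuation of binomial coefficients\<close>

text \<open>The sum equals \<open>2 ^ (M - k) * (M choose k)\<close>; the induction tracks only its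
  parity, by Pascal's rule on both factors.\<close>

lemma even_choose_mult_choose_sum:
  assumes "k < M"
  shows "even (\<Sum>i\<le>M. (M choose i) * (i choose k))"
  using assms
proof (induction M arbitrary: k)
  case (Suc M)
  have "(\<Sum>i\<le>Suc M. (Suc M choose i) * (i choose k))
      = (\<Sum>i\<le>M. (M choose i) * (Suc i choose k))
        + ((\<Sum>i\<le>M. (M choose Suc i) * (Suc i choose k)) + (0 choose k))"
    by (simp add: sum.atMost_Suc_shift sum.distrib algebra_simps del: sum.atMost_Suc)
  also have "(\<Sum>i\<le>M. (M choose Suc i) * (Suc i choose k)) + (0 choose k)
      = (\<Sum>i\<le>M. (M choose i) * (i choose k))"
    using sum.atMost_Suc_shift[of "\<lambda>i. (M choose i) * (i choose k)" M] by (simp add: binomial_eq_0)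
  finally have rec: "(\<Sum>i\<le>Suc M. (Suc M choose i) * (i choose k))
      = (\<Sum>i\<le>M. (M choose i) * (Suc i choose k)) + (\<Sum>i\<le>M. (M choose i) * (i choose k))" .
  show ?case
  proof (cases k)
    case 0
    thus ?thesis unfolding rec by simp
  next
    case (Suc k')
    hence "(\<Sum>i\<le>M. (M choose i) * (Suc i choose k))
      = (\<Sum>i\<le>M. (M choose i) * (i choose k')) + (\<Sum>i\<le>M. (M choose i) * (i choose k))"
      by (simp add: sum.distrib algebra_simps)
    thus ?thesis using Suc.IH[of k'] Suc.prems Suc unfolding rec by simp
  qed
qed simp

text \<open>Passing from \<open>M\<close> to \<open>Suc M\<close> adds an even sum by the previous
  lemma, so the parity comes from upper index \<open>k + 1\<close>, where the sum is 1. This gives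
  the odd total of the initial weights.\<close>

lemma odd_choose_mult_choose_sum:
  assumes "k < M"
  shows "odd (\<Sum>i<M. (M choose Suc i) * (i choose k))"
  using assms
proof (induction M)
  case (Suc M)
  have "(\<Sum>i<Suc M. (Suc M choose Suc i) * (i choose k))
      = (\<Sum>i<Suc M. (M choose i) * (i choose k)) + (\<Sum>i<Suc M. (M choose Suc i) * (i choose k))"
    by (simp add: sum.distrib algebra_simps del: sum.lessThan_Suc)
  also have "\<dots> = (\<Sum>i\<le>M. (M choose i) * (i choose k)) + (\<Sum>i<M. (M choose Suc i) * (i choose k))"
    by (simp add: lessThan_Suc_atMost[symmetric] binomial_eq_0)
  finally have "(\<Sum>i<Suc M. (Suc M choose Suc i) * (i choose k))
      = (\<Sum>i\<le>M. (M choose i) * (i choose k)) + (\<Sum>i<M. (M choose Suc i) * (i choose k))" .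
  moreover have "(\<Sum>i\<le>M. (M choose i) * (i choose M)) = (\<Sum>i\<le>M. if i = M then 1 else 0)"
    by (intro sum.cong) auto
  moreover have "(\<Sum>i<M. (M choose Suc i) * (i choose M)) = 0"
    by (auto intro!: sum.neutral)
  ultimately show ?case
    using Suc even_choose_mult_choose_sum[of k M]
    by (cases "k = M") (auto simp del: sum.lessThan_Suc sum.atMost_Suc)
qed simp

text \<open>With \<open>m = 3 * 2 ^ r\<close>, symmetry makes the lower index \<open>2 ^ r\<close>,
  and absorption gives \<open>2 * (m choose 2 ^ r) = 3 * ((m - 1) choose 2 ^ r)\<close>. The
  binomial is a factor of the initial weight at the annihilated index.\<close>

lemma even_choose_3_times_power:
  assumes "r > 0"
  shows "even ((3 * 2 ^ r - 1) choose (2 ^ Suc r - 1))"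
proof -
  let ?m = "3 * 2 ^ r :: nat"
  have "(3 * 2 ^ r - 1) choose (2 ^ Suc r - 1) = ((?m - 1) choose 2 ^ r)"
    using binomial_symmetric[of "2 ^ r" "?m - 1"] by simp
  moreover have "2 ^ r * (2 * (?m choose 2 ^ r)) = 2 ^ r * (3 * ((?m - 1) choose 2 ^ r))"
    using binomial_absorb_comp[of ?m "2 ^ r"] by (simp add: mult_ac)
  hence "2 * (?m choose 2 ^ r) = 3 * ((?m - 1) choose 2 ^ r)" by simp
  hence "even (3 * ((?m - 1) choose 2 ^ r))" by (metis dvd_triv_left)
  ultimately show ?thesis by simp
qed

section \<open>2-adic valuation of binomial coefficients\<close>

lemma multiplicity_2_add:
  fixes x y :: nat
  assumes "x > 0" "x < 2 ^ k" "2 ^ k dvd y"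
  shows "multiplicity 2 (y + x) = multiplicity 2 x"
proof (rule multiplicity_eqI)
  let ?v = "multiplicity 2 x"
  have x: "2 ^ n dvd x \<longleftrightarrow> n \<le> ?v" for n
    using assms(1) by (intro power_dvd_iff_le_multiplicity) auto
  have "?v < k"
    using x[of k] assms by (meson dvd_imp_le leD leI)
  hence y: "2 ^ Suc ?v dvd y" using assms(3) by (meson Suc_leI power_le_dvd)
  show "2 ^ ?v dvd y + x"
    using power_le_dvd[OF y, of ?v] x by simp
  show "\<not> 2 ^ Suc ?v dvd y + x"
    using x[of "Suc ?v"] dvd_add_right_iff[OF y] by simp
qed

lemma multiplicity_2_mult:
  "a \<noteq> 0 \<Longrightarrow> b \<noteq> 0 \<Longrightarrow> multiplicity 2 (a * b) = multiplicity 2 a + multiplicity 2 b" for a b :: nat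
  by (rule prime_elem_multiplicity_mult_distrib) auto

lemma multiplicity_2_fact: "multiplicity 2 (fact n :: nat) = (\<Sum>i\<in>{1..n}. multiplicity 2 i)"
  by (induction n) (simp_all add: multiplicity_2_mult del: mult_Suc)

lemma multiplicity_2_choose:
  "multiplicity 2 ((n + k) choose n) + (\<Sum>i\<in>{1..k}. multiplicity 2 i)
     = (\<Sum>i\<in>{1..k}. multiplicity 2 (n + i))"
proof -
  have "fact n * fact k * ((n + k) choose n) = (fact (n + k) :: nat)"
    using binomial_fact_lemma[of n "n + k"] by simp
  hence "multiplicity 2 (fact n * fact k * ((n + k) choose n) :: nat) = multiplicity 2 (fact (n + k) :: nat)"
    by simp
  hence "(\<Sum>i\<in>{1..n}. multiplicity 2 i) + (\<Sum>i\<in>{1..k}. multiplicity 2 i) + multiplicity 2 ((n + k) choose n)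
      = (\<Sum>i\<in>{1..n + k}. multiplicity 2 i)"
    by (simp add: multiplicity_2_mult multiplicity_2_fact)
  also have "\<dots> = (\<Sum>i\<in>{1..n}. multiplicity 2 i) + (\<Sum>i\<in>{1..k}. multiplicity 2 (n + i))"
    by (induction k) simp_all
  finally show ?thesis by simp
qed

text \<open>Up to \<open>n!\<close> the binomial is the product of \<open>3 * 2 ^ r + i\<close> for
  \<open>i < n\<close>. The factor with \<open>i = 0\<close> contributes \<open>r\<close>; the
  others have the valuations of \<open>1, ..., n - 1\<close> and cancel against
  \<open>n!\<close>.\<close>

lemma multiplicity_2_choose_le:
  assumes "n \<le> 2 ^ r"
  shows "multiplicity 2 ((n + (3 * 2 ^ r - 1)) choose n) \<le> r"
proof (cases n)
  case (Suc n')
  let ?M = "3 * 2 ^ r - 1 :: nat"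
  have M: "?M + Suc i = 3 * 2 ^ r + i" for i by simp
  have "(\<Sum>i\<in>{1..n}. multiplicity 2 (?M + i)) = (\<Sum>i\<le>n'. multiplicity 2 (3 * 2 ^ r + i))"
    unfolding Suc M[symmetric] by (simp only: One_nat_def sum.shift_bounds_cl_Suc_ivl atMost_atLeast0)
  also have "\<dots> = multiplicity 2 (3 * 2 ^ r :: nat) + (\<Sum>i\<in>{1..n'}. multiplicity 2 (3 * 2 ^ r + i))"
    by (simp add: sum.atLeast_Suc_atMost atMost_atLeast0)
  also have "multiplicity 2 (3 * 2 ^ r :: nat) = r"
    by (simp add: multiplicity_2_mult multiplicity_same_power not_dvd_imp_multiplicity_0)
  also have "(\<Sum>i\<in>{1..n'}. multiplicity 2 (3 * 2 ^ r + i)) = (\<Sum>i\<in>{1..n'}. multiplicity 2 i)"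
    by (intro sum.cong multiplicity_2_add[of _ r]) (use assms Suc in auto)
  finally have "(\<Sum>i\<in>{1..n}. multiplicity 2 (?M + i)) \<le> r + (\<Sum>i\<in>{1..n}. multiplicity 2 i)"
    by (simp add: Suc)
  moreover have "((n + k) choose n) = ((k + n) choose k)" for k
    using binomial_symmetric[of n "n + k"] by (simp add: add.commute)
  ultimately show ?thesis using multiplicity_2_choose[of ?M n] by (metis add_le_cancel_right)
qed simp

text \<open>No factor \<open>n + c\<close> is divisible by \<open>2 ^ (r + 2)\<close>, so the
  valuations depend only on the residue \<open>d\<close> of \<open>n\<close>. Moreover
  \<open>d \<le> 2 ^ r\<close>, as otherwise \<open>c = 2 ^ (r + 2) - d\<close> would violate the
  assumption.\<close>

lemma not_dvd_choose:
  assumes n: "\<And>c. 1 \<le> c \<Longrightarrow> c < 3 * 2 ^ r \<Longrightarrow> \<not> 2 ^ (r + 2) dvd n + c"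
  shows "\<not> 2 ^ Suc r dvd ((n + (3 * 2 ^ r - 1)) choose n)"
proof -
  let ?M = "3 * 2 ^ r - 1 :: nat"
  define d where "d = n mod 2 ^ (r + 2)"
  have dn: "2 ^ (r + 2) dvd n - d" "n = n - d + d" "d < 2 ^ (r + 2)"
    unfolding d_def by (simp_all add: minus_mod_eq_mult_div)
  have d: "d \<le> 2 ^ r"
  proof (rule ccontr)
    assume "\<not> d \<le> 2 ^ r"
    moreover have "2 ^ (r + 2) dvd n - d + d + (2 ^ (r + 2) - d)"
      using dn(1,3) by simp
    ultimately show False
      using n[of "2 ^ (r + 2) - d"] dn(2,3) by (simp add: not_le) 
  qed
  have "multiplicity 2 ((n + ?M) choose n) + (\<Sum>i\<in>{1..?M}. multiplicity 2 i)
      = (\<Sum>i\<in>{1..?M}. multiplicity 2 (n + i))"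
    by (rule multiplicity_2_choose)
  also have "\<dots> = (\<Sum>i\<in>{1..?M}. multiplicity 2 (d + i))"
  proof (intro sum.cong refl)
    fix i assume "i \<in> {1..?M}"
    hence "0 < d + i" "d + i < 2 ^ (r + 2)" using d by auto
    thus "multiplicity 2 (n + i) = multiplicity 2 (d + i)"
      using multiplicity_2_add[OF _ _ dn(1), of "d + i"] dn(2) by (simp add: add.assoc[symmetric])
  qed
  also have "\<dots> = multiplicity 2 ((d + ?M) choose d) + (\<Sum>i\<in>{1..?M}. multiplicity 2 i)"
    by (rule multiplicity_2_choose[symmetric])
  finally have "multiplicity 2 ((n + ?M) choose n) \<le> r"
    using multiplicity_2_choose_le[OF d] by simp
  moreover have "((n + ?M) choose n) \<noteq> 0" unfolding binomial_eq_0_iff by linarith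
  ultimately show ?thesis
    by (subst power_dvd_iff_le_multiplicity) auto
qed

section \<open>Divisibility of the section coefficients\<close>

lemma times_choose_diff:
  assumes "b > 0" "b \<le> n"
  shows "b * (n choose b) = (n - b + 1) * (n choose (b - 1))"
proof -
  have "n - b + 1 = n - (b - 1)" using assms by simp
  thus ?thesis
    using times_binomial_minus1_eq[OF assms(1), of n] binomial_absorb_comp[of n "b - 1"] by simp
qed

lemma power_dvd_below_3_times_cases:
  fixes j r :: nat
  assumes "2 ^ r dvd j" "0 < j" "j < 3 * 2 ^ r"
  shows "j = 2 ^ r \<or> j = 2 ^ Suc r"
proof -
  obtain k where k: "j = 2 ^ r * k" using assms(1) by blast
  hence "k < 3" "k > 0" using assms by auto
  hence "k = 1 \<or> k = 2" by linarith
  thus ?thesis using k by auto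
qed

lemma two_power_dvd_iff: "n > 0 \<Longrightarrow> 2 ^ k dvd n \<longleftrightarrow> k \<le> multiplicity 2 n" for n :: nat
  by (intro power_dvd_iff_le_multiplicity) auto

lemma odd_div_multiplicity: "n > 0 \<Longrightarrow> odd (n div 2 ^ multiplicity 2 n)" for n :: nat
  by (rule multiplicity_decompose) auto

lemma times_odd_part: "2 ^ multiplicity 2 n * (n div 2 ^ multiplicity 2 n) = n" for n :: nat
  using multiplicity_dvd[of 2 n] by simp

text \<open>The cases follow \<open>b = 2 * j - i\<close>. Odd quotients arise from
  \<open>b = 0\<close> and \<open>b = 1\<close>; for \<open>b \<ge> 2\<close> the power
  \<open>(-2)^b\<close> leaves a surplus factor 2. The delicate indices are \<open>j = 2 ^ r\<close>
  and \<open>j = 2 ^ Suc r\<close>.\<close>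

lemma section_coeff_dvd:
  assumes r: "r \<ge> 1" and i: "1 \<le> i" "i < 3 * 2 ^ r" and j: "1 \<le> j" "j < 3 * 2 ^ r"
  shows "\<exists>A. 2 ^ multiplicity 2 i * section_coeff (3 * 2 ^ r - 1) i j = 2 ^ Suc (multiplicity 2 j) * A \<and>
    (odd A \<longleftrightarrow> (i = 2 * j \<or> Suc i = 2 * j) \<and> i \<noteq> 2 ^ Suc r - 1)"
proof -
  let ?M = "3 * 2 ^ r - 1 :: nat"
  let ?v = "multiplicity 2 j"
  consider "2 * j < i" | "i = 2 * j" | "Suc i = 2 * j" "?v < r" | "Suc i = 2 * j" "r \<le> ?v"
    | b where "i + b = 2 * j" "b \<ge> 2"
  proof -
    assume a: thesis if "2 * j < i"
    assume b: thesis if "i = 2 * j"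
    assume c: thesis if "Suc i = 2 * j" "?v < r"
    assume d: thesis if "Suc i = 2 * j" "r \<le> ?v"
    assume e: thesis if "i + b = 2 * j" "b \<ge> 2" for b
    show thesis using a b c d e[of "2 * j - i"] by linarith
  qed
  thus ?thesis
  proof cases
    case 1
    thus ?thesis by (intro exI[of _ 0]) (auto simp: section_coeff_def)
  next
    case 2
    moreover have "i \<noteq> 2 ^ Suc r - 1"
    proof
      assume "i = 2 ^ Suc r - 1"
      hence "odd i" by simp
      thus False using 2 by simp
    qed
    ultimately show ?thesis
      using j by (intro exI[of _ 1]) (auto simp: section_coeff_def multiplicity_2_double)
  next
    case 3
    have "odd i" using 3(1) by presburger
    hence vi: "multiplicity 2 i = 0" by (rule not_dvd_imp_multiplicity_0)
    \<comment> \<open>For \<open>b = 1\<close> the binomial is \<open>3 * 2 ^ r - j\<close>; as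
      \<open>?v < r\<close>, its valuation is exactly \<open>?v\<close>.\<close>
    define q where "q = (3 * 2 ^ r - j) div 2 ^ ?v"
    have "\<not> 2 ^ Suc ?v dvd j" using j by (subst two_power_dvd_iff) auto
    moreover have "2 ^ Suc ?v dvd (2 ^ r :: nat)" using 3(2) by (intro le_imp_power_dvd) simp
    hence m: "2 ^ Suc ?v dvd (3 * 2 ^ r :: nat)" by (rule dvd_mult)
    ultimately have "\<not> 2 ^ Suc ?v dvd 3 * 2 ^ r - j"
      using j by (metis dvd_diffD1 less_imp_le_nat)
    moreover have q: "2 ^ ?v * q = 3 * 2 ^ r - j"
      unfolding q_def by (metis dvd_diff_nat dvd_mult_div_cancel m multiplicity_dvd power_le_dvd le_SucI order_refl)
    ultimately have "\<not> 2 ^ ?v * 2 dvd 2 ^ ?v * q" by (simp only: power_Suc2 q not_False_eq_True)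
    hence "odd q" using mult_dvd_mono[OF dvd_refl] by blast
    have "section_coeff ?M i j = - 2 * int (?M + j - i)"
    proof -
      have "2 * j - i = 1" using 3 by simp
      thus ?thesis using 3 unfolding section_coeff_def by simp
    qed
    also have "?M + j - i = 2 ^ ?v * q" unfolding q using 3 j by simp
    finally have "section_coeff ?M i j = 2 ^ Suc ?v * (- int q)" by simp
    moreover have "i \<noteq> 2 ^ Suc r - 1"
    proof
      assume "i = 2 ^ Suc r - 1"
      hence "j = 2 ^ r" using 3 by simp
      thus False using 3 by (simp add: multiplicity_same_power)
    qed
    ultimately show ?thesis
      using vi 3 \<open>odd q\<close> by (intro exI[of _ "- int q"]) simp
  next
    case 4
    have "odd i" using 4(1) by presburger
    hence vi: "multiplicity 2 i = 0" by (rule not_dvd_imp_multiplicity_0)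
    have "2 ^ r dvd j" using 4 j by (simp add: two_power_dvd_iff)
    \<comment> \<open>The alternative \<open>j = 2 ^ Suc r\<close> would make \<open>i\<close> too
      large. Here \<open>3 * 2 ^ r - j\<close> has one factor 2 more than \<open>j\<close>, which is
      why this index is annihilated modulo 2.\<close>
    hence "j = 2 ^ r" using power_dvd_below_3_times_cases[of r j] 4 i j by auto
    hence "?v = r" "2 * j - i = 1" "?M + j - i = 2 ^ Suc r" "i = 2 ^ Suc r - 1" "i \<le> 2 * j"
      using 4 by (simp_all add: multiplicity_same_power)
    thus ?thesis unfolding section_coeff_def vi
      by (intro exI[of _ "- 2"]) simp
  next
    case 5
    let ?n = "?M + j - i" and ?o = "i div 2 ^ multiplicity 2 i"
    have n: "b \<le> ?n" "?n - b + 1 = 3 * 2 ^ r - j" using 5 i j by linarith+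
    have c: "section_coeff ?M i j = (- 2) ^ b * int (?n choose b)"
    proof -
      have "2 * j - i = b" "i \<le> 2 * j" using 5 by auto
      thus ?thesis unfolding section_coeff_def by simp
    qed
    have "int (i * (?n choose b)) + int (b * (?n choose b)) = int (2 * j * (?n choose b))"
      unfolding of_nat_add[symmetric] add_mult_distrib[symmetric] using 5 by simp
    moreover have "b * (?n choose b) = (3 * 2 ^ r - j) * (?n choose (b - 1))"
      using times_choose_diff[of b ?n] 5(2) n(1) unfolding n(2) by simp
    hence "int (b * (?n choose b)) = int (3 * 2 ^ r - j) * int (?n choose (b - 1))"
      by (simp only: of_nat_mult)
    \<comment> \<open>Writing \<open>i\<close> as \<open>2 * j - b\<close> and absorbing
      \<open>b\<close> into the binomial trades the factor \<open>i\<close> for multiples of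
      \<open>j\<close> and of \<open>3 * 2 ^ r - j\<close>.\<close>
    ultimately have ic: "int i * int (?n choose b)
        = 2 * int j * int (?n choose b) - int (3 * 2 ^ r - j) * int (?n choose (b - 1))"
      by (simp only: of_nat_mult of_nat_numeral)
    have dvd: "2 ^ k dvd int i * int (?n choose b)" if "k \<le> ?v" "k \<le> r" for k
    proof -
      have *: "2 ^ k dvd j" using that j by (simp add: two_power_dvd_iff)
      have "2 ^ k dvd (2 ^ r :: nat)" using that by (intro le_imp_power_dvd)
      hence "2 ^ k dvd 3 * 2 ^ r - j" using * by (intro dvd_diff_nat dvd_mult)
      hence "2 ^ k dvd int j" "2 ^ k dvd int (3 * 2 ^ r - j)"
        using * by (metis of_nat_dvd_iff of_nat_numeral of_nat_power)+
      thus ?thesis unfolding ic by (intro dvd_diff) auto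
    qed
    have two: "(2::int) ^ k dvd (- 2) ^ b" if "k \<le> b" for k
      by (subst power_minus) (intro dvd_mult le_imp_power_dvd that)
    have "2 ^ (?v + 2) dvd int i * section_coeff ?M i j"
    proof (cases "?v \<le> r")
      case True
      hence "2 ^ ?v * 2 ^ 2 dvd (int i * int (?n choose b)) * (- 2) ^ b"
        using 5(2) by (intro mult_dvd_mono dvd two) auto
      thus ?thesis unfolding c by (simp add: power_add mult_ac)
    next
      case False
      \<comment> \<open>Now \<open>j = 2 ^ Suc r\<close>, but \<open>dvd\<close> provides only
        \<open>2 ^ r\<close>. The missing factor comes from \<open>b \<ge> 3\<close>, forced by the
        bound on \<open>i\<close>.\<close>
      have "2 ^ r dvd j" using False j by (simp add: two_power_dvd_iff)
      hence "j = 2 ^ Suc r" using power_dvd_below_3_times_cases[of r j] False j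
        by (auto simp: multiplicity_same_power)
      moreover have "?v = Suc r" unfolding calculation by (rule multiplicity_same_power) auto
      moreover have "(2::nat) ^ 1 \<le> 2 ^ r" using r by (intro power_increasing) auto
      ultimately have "b \<ge> 3" using 5 i by simp
      hence "2 ^ r * 2 ^ 3 dvd (int i * int (?n choose b)) * (- 2) ^ b"
        using False by (intro mult_dvd_mono dvd two) auto
      thus ?thesis unfolding c \<open>?v = Suc r\<close> by (simp add: power_add mult_ac)
    qed
    also have "int i = int ?o * 2 ^ multiplicity 2 i"
      by (subst times_odd_part[of i, symmetric]) simp
    finally have "2 ^ (?v + 2) dvd int ?o * (2 ^ multiplicity 2 i * section_coeff ?M i j)"
      by (simp add: mult_ac)
    moreover have "odd (int ?o)" using odd_div_multiplicity[of i] i by simp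
    hence "coprime (2 ^ (?v + 2)) (int ?o)"
      by (simp only: coprime_power_left_iff coprime_left_2_iff_odd) simp
    ultimately have "2 ^ (?v + 2) dvd 2 ^ multiplicity 2 i * section_coeff ?M i j"
      by (simp add: coprime_dvd_mult_right_iff)
    then obtain B where "2 ^ multiplicity 2 i * section_coeff ?M i j = 2 ^ (?v + 2) * B" by blast
    thus ?thesis using 5 by (intro exI[of _ "2 * B"]) auto
  qed
qed

subsection \<open>Iterating the doubling map\<close>

definition basis_coeff :: "nat \<Rightarrow> nat \<Rightarrow> nat \<Rightarrow> int" where
  "basis_coeff r i n =
     (fps_X ^ i * (1 - fps_X) ^ (3 * 2 ^ r - 1 - i) * thue_morse_fps ^ (3 * 2 ^ r)) $ n"

text \<open>The division is exact in the relevant range of indices, see \<open>section_coeff_dvd\<close>.\<close>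
definition transfer :: "nat \<Rightarrow> nat \<Rightarrow> nat \<Rightarrow> int" where
  "transfer r i j = 2 ^ multiplicity 2 i * section_coeff (3 * 2 ^ r - 1) i j div 2 ^ Suc (multiplicity 2 j)"

text \<open>Coordinates of \<open>c * (M choose c) * x^c\<close> in the scaled basis, with
  \<open>M = 3 * 2 ^ r - 1\<close>: the prefactor produces a factor \<open>i\<close>, whose 2-part
  goes into the scaling and whose odd part remains.\<close>

primrec weight :: "nat \<Rightarrow> nat \<Rightarrow> nat \<Rightarrow> nat \<Rightarrow> int" where
  "weight r c 0 = (\<lambda>i. int (((3 * 2 ^ r - 1) choose i) * ((i - 1) choose (c - 1)) * (i div 2 ^ multiplicity 2 i)))"
| "weight r c (Suc k) = (\<lambda>j. \<Sum>i\<in>{1..<3 * 2 ^ r}. weight r c k i * transfer r i j)"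

lemma transfer:
  assumes "r \<ge> 1" "1 \<le> i" "i < 3 * 2 ^ r" "1 \<le> j" "j < 3 * 2 ^ r"
  shows "2 ^ multiplicity 2 i * section_coeff (3 * 2 ^ r - 1) i j
       = 2 ^ Suc (multiplicity 2 j) * transfer r i j"
    and "odd (transfer r i j) \<longleftrightarrow> (i = 2 * j \<or> Suc i = 2 * j) \<and> i \<noteq> 2 ^ Suc r - 1"
proof -
  obtain A where A: "2 ^ multiplicity 2 i * section_coeff (3 * 2 ^ r - 1) i j = 2 ^ Suc (multiplicity 2 j) * A"
    "odd A \<longleftrightarrow> (i = 2 * j \<or> Suc i = 2 * j) \<and> i \<noteq> 2 ^ Suc r - 1"
    using section_coeff_dvd[OF assms] by blast
  moreover have "transfer r i j = A" unfolding transfer_def A(1) by simp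
  ultimately show "2 ^ multiplicity 2 i * section_coeff (3 * 2 ^ r - 1) i j
       = 2 ^ Suc (multiplicity 2 j) * transfer r i j"
    "odd (transfer r i j) \<longleftrightarrow> (i = 2 * j \<or> Suc i = 2 * j) \<and> i \<noteq> 2 ^ Suc r - 1"
    by simp_all
qed

lemma basis_coeff_double:
  assumes "1 \<le> i" "i < 3 * 2 ^ r"
  shows "basis_coeff r i (2 * n)
    = (\<Sum>j\<in>{1..<3 * 2 ^ r}. section_coeff (3 * 2 ^ r - 1) i j * basis_coeff r j n)"
proof -
  let ?m = "3 * 2 ^ r :: nat" and ?f = "thue_morse_fps ^ (3 * 2 ^ r)"
  have "basis_coeff r i (2 * n)
      = (fps_X ^ i * (1 - fps_X) ^ (?m - 1 - i) * ((1 - fps_X) ^ ?m * (?f oo fps_X ^ 2))) $ (2 * n)"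
    unfolding basis_coeff_def by (subst thue_morse_power_rec[of ?m]) (rule refl)
  also have "\<dots> = (fps_X ^ i * (1 - fps_X) ^ (?m - 1 - i + ?m) * (?f oo fps_X ^ 2)) $ (2 * n)"
    by (simp only: power_add mult_ac)
  also have "\<dots> = (\<Sum>j\<le>?m - 1. section_coeff (?m - 1) i j * basis_coeff r j n)"
    unfolding basis_coeff_def by (rule even_section) (use assms in simp)
  \<comment> \<open>As \<open>i \<ge> 1\<close>, the coefficient at \<open>j = 0\<close> vanishes,
    so index 0 never enters.\<close>
  also have "\<dots> = (\<Sum>j\<in>{1..<?m}. section_coeff (?m - 1) i j * basis_coeff r j n)"
    using assms by (intro sum.mono_neutral_right) (auto simp: section_coeff_def)
  finally show ?thesis .
qed

text \<open>Multiply \<open>x^c\<close> by \<open>(x + (1 - x))^(M - c) = 1\<close> and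
  expand.\<close>

lemma fps_X_power_expand:
  assumes "c \<le> M"
  shows "fps_X ^ c =
    (\<Sum>i\<in>{c..M}. fps_const (int ((M - c) choose (i - c))) * (fps_X ^ i * (1 - fps_X) ^ (M - i)))"
proof -
  have "fps_X ^ c = fps_X ^ c * (fps_X + (1 - fps_X :: int fps)) ^ (M - c)" by simp
  also have "\<dots> = (\<Sum>l\<le>M - c. fps_const (int ((M - c) choose l)) *
      (fps_X ^ (l + c) * (1 - fps_X) ^ (M - (l + c))))"
    unfolding binomial_ring sum_distrib_left fps_of_nat
    by (intro sum.cong refl) (simp add: power_add mult_ac add.commute)
  also have "\<dots> = (\<Sum>i\<in>{c..M}. fps_const (int ((M - c) choose (i - c))) *
      (fps_X ^ i * (1 - fps_X) ^ (M - i)))"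
    using assms by (intro sum.reindex_bij_witness[of _ "\<lambda>i. i - c" "\<lambda>l. l + c"]) auto
  finally show ?thesis .
qed

lemma choose_product_identity:
  assumes "1 \<le> c" "c \<le> i" "i \<le> M"
  shows "c * (M choose c) * ((M - c) choose (i - c)) = (M choose i) * ((i - 1) choose (c - 1)) * i"
proof -
  have "c * (M choose c) * ((M - c) choose (i - c)) = c * ((M choose i) * (i choose c))"
    using choose_mult[of c i M] assms by simp
  also have "\<dots> = (M choose i) * (c * (i choose c))" by simp
  also have "\<dots> = (M choose i) * (i * ((i - 1) choose (c - 1)))"
    using times_binomial_minus1_eq[of c i] assms by simp
  finally show ?thesis by (simp only: mult_ac)
qed

text \<open>Each halving of the argument extracts one factor 2 through \<open>transfer\<close>; the
  induction hypothesis is used at \<open>2 * n\<close>.\<close>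

lemma coeff_basis_expansion:
  assumes r: "r \<ge> 1" and c: "1 \<le> c" "c < 3 * 2 ^ r"
  shows "int (c * ((3 * 2 ^ r - 1) choose c)) * (fps_X ^ c * thue_morse_fps ^ (3 * 2 ^ r)) $ (2 ^ k * n)
    = 2 ^ k * (\<Sum>i\<in>{1..<3 * 2 ^ r}. weight r c k i * (2 ^ multiplicity 2 i * basis_coeff r i n))"
proof (induction k arbitrary: n)
  case 0
  let ?M = "3 * 2 ^ r - 1 :: nat" and ?f = "thue_morse_fps ^ (3 * 2 ^ r)"
  have "(fps_X ^ c * ?f) $ n = (\<Sum>i\<in>{c..?M}. int ((?M - c) choose (i - c)) * basis_coeff r i n)"
    using c by (subst fps_X_power_expand[of c ?M])
      (auto simp: sum_distrib_right fps_sum_nth basis_coeff_def mult.assoc)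
  hence "int (c * (?M choose c)) * (fps_X ^ c * ?f) $ n
      = (\<Sum>i\<in>{c..?M}. int (c * (?M choose c) * ((?M - c) choose (i - c))) * basis_coeff r i n)"
    by (simp add: sum_distrib_left mult_ac)
  also have "\<dots> = (\<Sum>i\<in>{c..?M}. weight r c 0 i * (2 ^ multiplicity 2 i * basis_coeff r i n))"
  proof (intro sum.cong refl)
    fix i assume i: "i \<in> {c..?M}"
    have "int (c * (?M choose c) * ((?M - c) choose (i - c)))
        = int ((?M choose i) * ((i - 1) choose (c - 1)) * (2 ^ multiplicity 2 i * (i div 2 ^ multiplicity 2 i)))"
      unfolding times_odd_part using choose_product_identity[of c i ?M] c i by simp
    thus "int (c * (?M choose c) * ((?M - c) choose (i - c))) * basis_coeff r i n
        = weight r c 0 i * (2 ^ multiplicity 2 i * basis_coeff r i n)"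
      by simp
  qed
  \<comment> \<open>For \<open>i < c\<close> the factor \<open>(i - 1) choose (c - 1)\<close> of the
    weight is 0.\<close>
  also have "\<dots> = (\<Sum>i\<in>{1..<3 * 2 ^ r}. weight r c 0 i * (2 ^ multiplicity 2 i * basis_coeff r i n))"
    using c by (intro sum.mono_neutral_left) (auto simp: binomial_eq_0)
  finally show ?case by simp
next
  case (Suc k)
  let ?m = "3 * 2 ^ r :: nat"
  have "int (c * ((?m - 1) choose c)) * (fps_X ^ c * thue_morse_fps ^ ?m) $ (2 ^ Suc k * n)
      = 2 ^ k * (\<Sum>i\<in>{1..<?m}. weight r c k i * (2 ^ multiplicity 2 i * basis_coeff r i (2 * n)))"
    using Suc.IH[of "2 * n"] by (simp add: mult_ac)
  also have "(\<Sum>i\<in>{1..<?m}. weight r c k i * (2 ^ multiplicity 2 i * basis_coeff r i (2 * n)))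
      = (\<Sum>i\<in>{1..<?m}. \<Sum>j\<in>{1..<?m}. 2 * (weight r c k i * transfer r i j * (2 ^ multiplicity 2 j * basis_coeff r j n)))"
  proof (intro sum.cong refl)
    fix i assume i: "i \<in> {1..<?m}"
    have "2 ^ multiplicity 2 i * basis_coeff r i (2 * n)
        = (\<Sum>j\<in>{1..<?m}. 2 ^ multiplicity 2 i * section_coeff (?m - 1) i j * basis_coeff r j n)"
      using basis_coeff_double[of i r n] i by (simp add: sum_distrib_left mult_ac)
    also have "\<dots> = (\<Sum>j\<in>{1..<?m}. 2 * (transfer r i j * (2 ^ multiplicity 2 j * basis_coeff r j n)))"
      using i r by (intro sum.cong refl) (subst transfer(1), auto)
    finally show "weight r c k i * (2 ^ multiplicity 2 i * basis_coeff r i (2 * n))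
        = (\<Sum>j\<in>{1..<?m}. 2 * (weight r c k i * transfer r i j * (2 ^ multiplicity 2 j * basis_coeff r j n)))"
      by (simp add: sum_distrib_left mult_ac)
  qed
  also have "\<dots> = 2 * (\<Sum>j\<in>{1..<?m}. weight r c (Suc k) j * (2 ^ multiplicity 2 j * basis_coeff r j n))"
    by (subst sum.swap) (simp add: sum_distrib_left sum_distrib_right mult_ac)
  finally show ?case by simp
qed

text \<open>
  For \<open>r \<ge> 2\<close> no index below \<open>3 * 2 ^ r\<close> is moved to \<open>2 ^ Suc r - 1\<close>, the index annihilated modulo 2;
  for \<open>r = 1\<close> the index 5 is moved to 3.
\<close>
lemma weight_annihilated_index_even:
  assumes "r \<ge> 2" "1 \<le> c"
  shows "even (weight r c k (2 ^ Suc r - 1))"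
proof (cases k)
  case 0
  thus ?thesis using even_choose_3_times_power[of r] assms by simp
next
  case (Suc k')
  let ?s = "2 ^ Suc r - 1 :: nat"
  have "(2::nat) ^ 2 \<le> 2 ^ r" using assms by (intro power_increasing) auto
  hence s: "1 \<le> ?s" "?s < 3 * 2 ^ r" "3 * 2 ^ r < 2 * ?s" by simp_all
  hence "even (transfer r i ?s)" if "i \<in> {1..<3 * 2 ^ r}" for i
    using transfer(2)[of r i ?s] that assms by auto
  thus ?thesis unfolding Suc weight.simps(2) by (intro dvd_sum dvd_mult) auto
qed

text \<open>An odd matrix entry from \<open>i\<close> to \<open>j\<close> forces
  \<open>i - 1 \<ge> 2 * (j - 1)\<close>, so an odd weight at \<open>j\<close> after
  \<open>k\<close> steps would trace back to a starting index beyond the range.\<close>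

lemma weight_even:
  assumes "r \<ge> 2" "j \<in> {1..<3 * 2 ^ r}" "3 * 2 ^ r - 1 \<le> (j - 1) * 2 ^ k"
  shows "even (weight r c k j)"
  using assms(2,3)
proof (induction k arbitrary: j)
  case 0
  thus ?case by auto
next
  case (Suc k)
  show ?case unfolding weight.simps(2)
  proof (intro dvd_sum)
    fix i :: nat assume i: "i \<in> {1..<3 * 2 ^ r}"
    show "even (weight r c k i * transfer r i j)"
    proof (cases "odd (transfer r i j)")
      case True
      hence "i = 2 * j \<or> Suc i = 2 * j"
        using transfer(2)[of r i j] i Suc.prems assms(1) by auto
      hence "2 * (j - 1) \<le> i - 1" by auto
      hence "2 * (j - 1) * 2 ^ k \<le> (i - 1) * 2 ^ k" by (rule mult_right_mono) simp
      moreover have "(j - 1) * 2 ^ Suc k = 2 * (j - 1) * 2 ^ k" by simp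
      ultimately have "3 * 2 ^ r - 1 \<le> (i - 1) * 2 ^ k" using Suc.prems(2) by linarith
      thus ?thesis using Suc.IH[OF i] by simp
    qed simp
  qed
qed

text \<open>Modulo 2 each row \<open>i\<close> has a single nonzero entry, at
  \<open>Suc i div 2\<close>, except the annihilated row, where the weight is even. So the parity of
  the total is invariant.\<close>

lemma odd_sum_weight:
  assumes r: "r \<ge> 2" and c: "1 \<le> c" "c < 3 * 2 ^ r"
  shows "odd (\<Sum>i\<in>{1..<3 * 2 ^ r :: nat}. weight r c k i)"
proof (induction k)
  case 0
  let ?M = "3 * 2 ^ r - 1 :: nat"
  have "even (\<Sum>i\<in>{1..<3 * 2 ^ r}. weight r c 0 i - int ((?M choose i) * ((i - 1) choose (c - 1))))"
  proof (intro dvd_sum)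
    fix i :: nat assume "i \<in> {1..<3 * 2 ^ r}"
    hence "odd (i div 2 ^ multiplicity 2 i)" by (intro odd_div_multiplicity) auto
    thus "even (weight r c 0 i - int ((?M choose i) * ((i - 1) choose (c - 1))))"
      by simp
  qed
  hence "even ((\<Sum>i\<in>{1..<3 * 2 ^ r}. weight r c 0 i)
      - int (\<Sum>i\<in>{1..<3 * 2 ^ r}. (?M choose i) * ((i - 1) choose (c - 1))))"
    by (simp add: sum_subtractf)
  moreover have "(\<Sum>i\<in>{1..<3 * 2 ^ r :: nat}. (?M choose i) * ((i - 1) choose (c - 1)))
      = (\<Sum>i<?M. (?M choose Suc i) * (i choose (c - 1)))"
    by (intro sum.reindex_bij_witness[of _ Suc "\<lambda>i. i - 1"]) auto
  moreover have "odd (int (\<Sum>i<?M. (?M choose Suc i) * (i choose (c - 1))))"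
    using odd_choose_mult_choose_sum[of "c - 1" ?M] c by (simp del: of_nat_sum of_nat_mult)
  ultimately show ?case by (simp only: even_diff even_add not_False_eq_True)
next
  case (Suc k)
  let ?I = "{1..<3 * 2 ^ r} :: nat set"
  have "even (\<Sum>i\<in>?I. weight r c k i * ((\<Sum>j\<in>?I. transfer r i j) - 1))"
  proof (intro dvd_sum)
    fix i assume i: "i \<in> ?I"
    show "even (weight r c k i * ((\<Sum>j\<in>?I. transfer r i j) - 1))"
    proof (cases "i = 2 ^ Suc r - 1")
      case True
      thus ?thesis using weight_annihilated_index_even[OF r c(1)] by simp
    next
      case False
      let ?h = "Suc i div 2"
      have h: "?h \<in> ?I" using i by auto
      have "odd (transfer r i ?h)"
        using transfer(2)[of r i ?h] i h r False by auto
      moreover have "even (\<Sum>j\<in>?I - {?h}. transfer r i j)"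
      proof (intro dvd_sum)
        fix j assume j: "j \<in> ?I - {?h}"
        hence "i \<noteq> 2 * j" "Suc i \<noteq> 2 * j" by auto
        thus "even (transfer r i j)"
          using transfer(2)[of r i j] i j r by auto
      qed
      ultimately have "odd (\<Sum>j\<in>?I. transfer r i j)"
        using h by (subst sum.remove[of _ ?h]) auto
      thus ?thesis by simp
    qed
  qed
  moreover have "(\<Sum>i\<in>?I. weight r c k i * ((\<Sum>j\<in>?I. transfer r i j) - 1))
      = (\<Sum>j\<in>?I. weight r c (Suc k) j) - (\<Sum>i\<in>?I. weight r c k i)"
    by (simp add: right_diff_distrib sum_subtractf sum_distrib_left) (rule sum.swap)
  ultimately show ?case using Suc.IH by simp
qed

section \<open>Comparison with the binomial series\<close>

lemma one_minus_fps_X_power_inverse: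
  "(1 - fps_X) ^ Suc M * Abs_fps (\<lambda>n. int ((n + M) choose n)) = 1"
proof (induction M)
  case 0
  show ?case by (intro fps_ext) (simp add: left_diff_distrib)
next
  case (Suc M)
  have "(1 - fps_X) * Abs_fps (\<lambda>n. int ((n + Suc M) choose n)) = Abs_fps (\<lambda>n. int ((n + M) choose n))"
  proof (rule fps_ext)
    fix n
    show "((1 - fps_X) * Abs_fps (\<lambda>n. int ((n + Suc M) choose n))) $ n
        = Abs_fps (\<lambda>n. int ((n + M) choose n)) $ n"
      by (cases n) (simp_all add: left_diff_distrib)
  qed
  hence "(1 - fps_X) ^ Suc M * ((1 - fps_X) * Abs_fps (\<lambda>n. int ((n + Suc M) choose n))) = 1"
    using Suc by simp
  thus ?case by (simp only: power_Suc2 mult.assoc)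
qed

text \<open>Modulo 2 the series is \<open>x (1 - x)^(m-2) (1 - x)^(-m) = x / (1 - x)^2\<close>,
  whose coefficient at \<open>n\<close> is \<open>n\<close>.\<close>

lemma basis_coeff_1_odd:
  assumes "odd n" "r \<ge> 1"
  shows "odd (basis_coeff r 1 n)"
proof -
  let ?m = "3 * 2 ^ r :: nat" and ?D = "Abs_fps (\<lambda>n. int ((n + 1) choose n))"
  obtain W where W: "thue_morse_fps ^ ?m * (1 - fps_X) ^ ?m = 1 + 2 ^ Suc r * W"
    using thue_morse_power_cong by blast
  have "(2::nat) ^ 1 \<le> 2 ^ r" using assms by (intro power_increasing) auto
  hence m: "?m = ?m - 1 - 1 + 2" by simp
  have D: "(1 - fps_X) ^ 2 * ?D = 1"
    using one_minus_fps_X_power_inverse[of 1] by (simp add: numeral_2_eq_2)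
  have "fps_X ^ 1 * (1 - fps_X) ^ (?m - 1 - 1) * thue_morse_fps ^ ?m
      = fps_X * ((1 - fps_X) ^ (?m - 1 - 1) * thue_morse_fps ^ ?m * ((1 - fps_X) ^ 2 * ?D))"
    unfolding D by (simp add: mult_ac)
  also have "\<dots> = fps_X * ?D * (thue_morse_fps ^ ?m * (1 - fps_X) ^ (?m - 1 - 1 + 2))"
    by (simp only: power_add mult_ac)
  also have "\<dots> = fps_X * ?D * (1 + 2 ^ Suc r * W)"
    unfolding W[symmetric] m[symmetric] ..
  also have "\<dots> = fps_X * ?D + fps_const 2 * (fps_const 2 ^ r * W * fps_X * ?D)"
    by (simp add: numeral_fps_const algebra_simps)
  finally have "basis_coeff r 1 n = (fps_X * ?D) $ n + 2 * (fps_const 2 ^ r * W * fps_X * ?D) $ n"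
    unfolding basis_coeff_def by simp
  moreover have "(fps_X * ?D) $ n = int n"
    using assms by (cases n) auto
  ultimately show ?thesis using assms by simp
qed

text \<open>As \<open>2 ^ k\<close> exceeds every index, all weights except that of index 1 are
  even; the odd total then makes that one odd.\<close>

lemma odd_expansion:
  assumes r: "r \<ge> 2" and c: "1 \<le> c" "c < 3 * 2 ^ r" and n: "odd n" and k: "r + 2 \<le> k"
  shows "odd (\<Sum>i\<in>{1..<3 * 2 ^ r}. weight r c k i * (2 ^ multiplicity 2 i * basis_coeff r i n))"
proof -
  let ?I = "{1..<3 * 2 ^ r} :: nat set"
  have "(2::nat) ^ (r + 2) \<le> 2 ^ k" using k by (intro power_increasing) auto
  hence "even (weight r c k i)" if "i \<in> ?I - {1}" for i
  proof -
    have "1 * 2 ^ k \<le> (i - 1) * 2 ^ k" using that by (intro mult_right_mono) auto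
    moreover have "3 * 2 ^ r \<le> (2::nat) ^ k" using \<open>2 ^ (r + 2) \<le> 2 ^ k\<close> by simp
    ultimately have "3 * 2 ^ r - 1 \<le> (i - 1) * 2 ^ k" by linarith
    thus ?thesis using that by (intro weight_even[OF r]) auto
  qed
  hence *: "even (\<Sum>i\<in>?I - {1}. weight r c k i * g i)" for g :: "nat \<Rightarrow> int"
    by (intro dvd_sum) auto
  have split: "(\<Sum>i\<in>?I. weight r c k i * g i)
      = weight r c k 1 * g 1 + (\<Sum>i\<in>?I - {1}. weight r c k i * g i)" for g :: "nat \<Rightarrow> int"
    using c by (intro sum.remove) auto
  have "odd (weight r c k 1)"
    using odd_sum_weight[OF r c, of k] split[of "\<lambda>_. 1"] *[of "\<lambda>_. 1"] by simp
  thus ?thesis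
    unfolding split[of "\<lambda>i. 2 ^ multiplicity 2 i * basis_coeff r i n"]
    using *[of "\<lambda>i. 2 ^ multiplicity 2 i * basis_coeff r i n"] basis_coeff_1_odd[OF n, of r] r by simp
qed

text \<open>Modulo \<open>2 ^ Suc r\<close> the coefficient is that of \<open>(1 - x)^(-m)\<close>,
  the binomial of \<open>not_dvd_choose\<close>.\<close>

lemma not_dvd_thue_morse_power_coeff:
  assumes "\<And>c. 1 \<le> c \<Longrightarrow> c < 3 * 2 ^ r \<Longrightarrow> \<not> 2 ^ (r + 2) dvd n + c"
  shows "\<not> 2 ^ Suc r dvd thue_morse_power_coeff (3 * 2 ^ r) n"
proof
  let ?m = "3 * 2 ^ r :: nat" and ?B = "Abs_fps (\<lambda>n. int ((n + (3 * 2 ^ r - 1)) choose n))"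
  assume dvd: "2 ^ Suc r dvd thue_morse_power_coeff (3 * 2 ^ r) n"
  obtain W where W: "thue_morse_fps ^ ?m * (1 - fps_X) ^ ?m = 1 + 2 ^ Suc r * W"
    using thue_morse_power_cong by blast
  have "(1 - fps_X) ^ ?m * ?B = 1"
    using one_minus_fps_X_power_inverse[of "?m - 1"] by simp
  hence "thue_morse_fps ^ ?m = thue_morse_fps ^ ?m * (1 - fps_X) ^ ?m * ?B"
    by (simp only: mult.assoc mult_1_right)
  also note W
  also have "(1 + 2 ^ Suc r * W) * ?B = ?B + 2 ^ Suc r * (W * ?B)"
    by (simp only: distrib_right mult_1_left mult.assoc)
  also have "(2::int fps) ^ Suc r = fps_const (2 ^ Suc r)"
    by (simp only: numeral_fps_const fps_const_power)
  finally have eq: "thue_morse_fps ^ ?m = ?B + fps_const (2 ^ Suc r) * (W * ?B)" .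
  have "thue_morse_power_coeff ?m n = int ((n + (?m - 1)) choose n) + 2 ^ Suc r * (W * ?B) $ n"
    unfolding thue_morse_power_coeff_def eq
    by (simp only: fps_add_nth fps_mult_left_const_nth fps_nth_Abs_fps)
  hence "int ((n + (?m - 1)) choose n) = thue_morse_power_coeff ?m n - 2 ^ Suc r * (W * ?B) $ n"
    by simp
  hence "int (2 ^ Suc r) dvd int ((n + (?m - 1)) choose n)"
    using dvd by (simp only: of_nat_power of_nat_numeral dvd_diff dvd_triv_left)
  hence "2 ^ Suc r dvd ((n + (?m - 1)) choose n)"
    by (simp only: of_nat_dvd_iff)
  thus False using not_dvd_choose[OF assms] by simp
qed

subsection \<open>The odd part\<close>

lemma signed_odd_part_eq: "odd u \<Longrightarrow> signed_odd_part (2 ^ e * u) = u"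
proof -
  assume u: "odd u"
  hence "multiplicity 2 (2 ^ e * u) = e"
    by (intro multiplicity_eqI) auto
  thus ?thesis using u unfolding signed_odd_part_def by auto
qed

lemma signed_odd_part_cases:
  fixes a :: int
  assumes "a \<noteq> 0"
  obtains e u where "a = 2 ^ e * u" "odd u" "signed_odd_part a = u"
proof -
  obtain u where "a = 2 ^ multiplicity 2 a * u" "odd u"
    using multiplicity_decompose'[of a 2] assms by auto
  thus thesis using that signed_odd_part_eq by metis
qed

lemma signed_odd_part_mult: "signed_odd_part (a * b) = signed_odd_part a * signed_odd_part b"
proof (cases "a = 0 \<or> b = 0")
  case True
  thus ?thesis by (auto simp: signed_odd_part_def)
next
  case False
  then obtain e u f v where a: "a = 2 ^ e * u" "odd u" "signed_odd_part a = u"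
    and b: "b = 2 ^ f * v" "odd v" "signed_odd_part b = v"
    using signed_odd_part_cases[of a] signed_odd_part_cases[of b] by metis
  have "a * b = 2 ^ (e + f) * (u * v)" unfolding a(1) b(1) by (simp add: power_add)
  moreover have "signed_odd_part (2 ^ (e + f) * (u * v)) = u * v"
    by (rule signed_odd_part_eq) (use a(2) b(2) in simp)
  ultimately show ?thesis using a(3) b(3) by metis
qed

text \<open>The valuation \<open>v\<close> of \<open>a\<close> is below \<open>e\<close>, so
  \<open>b\<close> has the same valuation, and division by \<open>2 ^ v\<close> preserves the
  congruence modulo \<open>2 ^ s\<close>.\<close>

lemma signed_odd_part_cong:
  assumes dvd: "2 ^ (s + e) dvd a - b" and a: "\<not> 2 ^ e dvd a"
  shows "2 ^ s dvd signed_odd_part a - signed_odd_part b"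
proof -
  have "a \<noteq> 0" using a by auto
  then obtain v u where u: "a = 2 ^ v * u" "odd u" "signed_odd_part a = u"
    by (rule signed_odd_part_cases)
  have "v < e" using a u(1) by (metis dvd_triv_left leI power_le_dvd)
  obtain z where "a - b = 2 ^ (s + e) * z" using dvd by blast
  \<comment> \<open>One factor 2 is kept apart so that the cofactor of \<open>b\<close> is odd even
    when \<open>s = 0\<close>.\<close>
  moreover have "(2::int) ^ (s + e) = 2 ^ v * (2 ^ (s + (e - v - 1)) * 2)"
    using \<open>v < e\<close> by (simp add: power_add[symmetric] power_Suc2[symmetric] del: power_Suc)
  ultimately have b: "b = 2 ^ v * (u - 2 ^ (s + (e - v - 1)) * 2 * z)"
    using u(1) by (simp add: algebra_simps)
  have "signed_odd_part b = u - 2 ^ (s + (e - v - 1)) * 2 * z"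
    unfolding b by (rule signed_odd_part_eq) (use u(2) in simp)
  thus ?thesis unfolding u(3) by (simp add: power_add mult.assoc)
qed

section \<open>Residues that a finite automaton computes\<close>

lemma fps_mult_nth_bounded:
  fixes P g :: "int fps"
  assumes P: "\<And>l. l \<ge> d \<Longrightarrow> P $ l = 0"
  shows "(P * g) $ n = (\<Sum>l<d. P $ l * (fps_X ^ l * g) $ n)"
proof -
  have "(P * g) $ n = (\<Sum>l\<le>n. P $ l * g $ (n - l))" by (simp add: fps_mult_nth atLeast0AtMost)
  also have "\<dots> = (\<Sum>l<d. P $ l * (fps_X ^ l * g) $ n)"
    by (intro sum.mono_neutral_cong) (auto simp: fps_X_power_mult_nth P)
  finally show ?thesis .
qed

lemma one_minus_fps_X_power_nth_eq_0: "k > m \<Longrightarrow> ((1 - fps_X) ^ m :: int fps) $ k = 0"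
proof (induction m arbitrary: k)
  case (Suc m)
  thus ?case by (cases k) (simp_all add: left_diff_distrib)
qed simp

lemma fps_X_one_minus_power_nth_eq_0:
  "k > i + m \<Longrightarrow> (fps_X ^ i * (1 - fps_X) ^ m :: int fps) $ k = 0"
  by (simp add: fps_X_power_mult_nth one_minus_fps_X_power_nth_eq_0)

lemma sum_mult_cong:
  fixes p :: int
  assumes "\<And>i. i \<in> I \<Longrightarrow> p dvd x i - x' i"
  shows "p dvd (\<Sum>i\<in>I. c i * x i) - (\<Sum>i\<in>I. c i * x' i)"
proof -
  have "p dvd (\<Sum>i\<in>I. c i * (x i - x' i))" by (intro dvd_sum dvd_mult assms)
  thus ?thesis by (simp add: right_diff_distrib sum_subtractf)
qed

text \<open>Entry \<open>i\<close> is \<open>t_m(n - i)\<close> modulo \<open>2 ^ p\<close>; the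
  shift by \<open>x^i\<close> makes it 0 for \<open>i > n\<close>.\<close>

definition residue_vector :: "nat \<Rightarrow> nat \<Rightarrow> nat \<Rightarrow> int list" where
  "residue_vector m p n = map (\<lambda>i. (fps_X ^ i * thue_morse_fps ^ m) $ n mod 2 ^ p) [0..<m]"

lemma residue_vector_eq_iff:
  "residue_vector m p n = residue_vector m p n' \<longleftrightarrow>
     (\<forall>i<m. 2 ^ p dvd (fps_X ^ i * thue_morse_fps ^ m) $ n - (fps_X ^ i * thue_morse_fps ^ m) $ n')"
  unfolding residue_vector_def map_eq_conv by (auto simp: mod_eq_dvd_iff)

lemma residue_vector_combination:
  fixes P :: "int fps"
  assumes P: "\<And>l. l \<ge> m \<Longrightarrow> P $ l = 0" and eq: "residue_vector m p n = residue_vector m p n'"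
  shows "2 ^ p dvd (P * thue_morse_fps ^ m) $ n - (P * thue_morse_fps ^ m) $ n'"
proof -
  have nth: "(P * thue_morse_fps ^ m) $ n = (\<Sum>l<m. P $ l * (fps_X ^ l * thue_morse_fps ^ m) $ n)" for n
    by (rule fps_mult_nth_bounded) (rule P)
  show ?thesis
    unfolding nth by (rule sum_mult_cong) (use eq[unfolded residue_vector_eq_iff] in auto)
qed

text \<open>By the functional equation \<open>x^i f = P(x) f(x^2)\<close>, where
  \<open>P = x^i (1 - x)^m\<close> has degree below \<open>2 * m\<close>; so the window of length
  \<open>m\<close> at \<open>n\<close> determines the one at \<open>2 * n + b\<close>.\<close>

lemma residue_vector_digit:
  assumes eq: "residue_vector m p n = residue_vector m p n'" and b: "b < 2"
  shows "residue_vector m p (2 * n + b) = residue_vector m p (2 * n' + b)"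
  unfolding residue_vector_eq_iff
proof (intro allI impI)
  fix i assume i: "i < m"
  let ?f = "thue_morse_fps ^ m" and ?P = "fps_X ^ i * (1 - fps_X) ^ m :: int fps"
  have P: "?P $ l = 0" if "l \<ge> 2 * m" for l
    by (rule fps_X_one_minus_power_nth_eq_0) (use that i in simp)
  have "fps_X ^ i * ?f = ?P * (?f oo fps_X ^ 2)"
    by (subst thue_morse_power_rec) (simp only: mult.assoc)
  hence nth: "(fps_X ^ i * ?f) $ (2 * n + b) = (\<Sum>l<m. ?P $ (2 * l + b) * (fps_X ^ l * ?f) $ n)" for n
    using fps_double_argument_nth[where d = m and P = "?P" and g = "?f", OF P b] by (simp only:)
  show "2 ^ p dvd (fps_X ^ i * ?f) $ (2 * n + b) - (fps_X ^ i * ?f) $ (2 * n' + b)"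
    unfolding nth by (rule sum_mult_cong) (use eq[unfolded residue_vector_eq_iff] in auto)
qed

lemma finite_range_mod_list:
  "finite (range (\<lambda>n. map (\<lambda>x. f n x mod 2 ^ p) xs))" for f :: "'c \<Rightarrow> 'd \<Rightarrow> int"
proof (rule finite_subset)
  show "range (\<lambda>n. map (\<lambda>x. f n x mod 2 ^ p) xs) \<subseteq> {ys. set ys \<subseteq> {0..<2 ^ p} \<and> length ys = length xs}"
    by auto
qed (intro finite_lists_length_eq, simp)

lemma digit_congruent_residue_vector: "digit_congruent (residue_vector m p)"
proof (rule digit_congruentI)
  show "finite (range (residue_vector m p))"
    unfolding residue_vector_def by (rule finite_range_mod_list)
  show "residue_vector m p (2 * n) = residue_vector m p (2 * n')"
    "residue_vector m p (Suc (2 * n)) = residue_vector m p (Suc (2 * n'))"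
    if "residue_vector m p n = residue_vector m p n'" for n n'
    using residue_vector_digit[OF that, of 0] residue_vector_digit[OF that, of 1] by simp_all
qed

text \<open>All \<open>c\<close> are recorded at once, since one state must serve whichever
  \<open>c\<close> occurs.\<close>

definition weight_residues :: "nat \<Rightarrow> nat \<Rightarrow> nat \<Rightarrow> int list" where
  "weight_residues r p k = map (\<lambda>x. weight r (fst x) k (snd x) mod 2 ^ p)
     (List.product [1..<3 * 2 ^ r] [1..<3 * 2 ^ r])"

lemma weight_residues_eq_iff:
  "weight_residues r p k = weight_residues r p k' \<longleftrightarrow>
     (\<forall>c\<in>{1..<3 * 2 ^ r}. \<forall>i\<in>{1..<3 * 2 ^ r}. 2 ^ p dvd weight r c k i - weight r c k' i)"
  unfolding weight_residues_def map_eq_conv by (auto simp: mod_eq_dvd_iff)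

text \<open>The recursion is linear over the integers, so it acts on residues. With finiteness this
  stands in for an explicit period in \<open>k\<close>.\<close>

lemma weight_residues_Suc:
  assumes "weight_residues r p k = weight_residues r p k'"
  shows "weight_residues r p (Suc k) = weight_residues r p (Suc k')"
  unfolding weight_residues_eq_iff weight.simps(2)
proof (intro ballI)
  fix c j :: nat assume c: "c \<in> {1..<3 * 2 ^ r}" 
  show "2 ^ p dvd (\<Sum>i\<in>{1..<3 * 2 ^ r}. weight r c k i * transfer r i j)
      - (\<Sum>i\<in>{1..<3 * 2 ^ r}. weight r c k' i * transfer r i j)"
    using sum_mult_cong[of "{1..<3 * 2 ^ r}" "2 ^ p" "weight r c k" "weight r c k'" "\<lambda>i. transfer r i j"]
      assms[unfolded weight_residues_eq_iff] c by (simp add: mult.commute)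
qed

lemma finite_range_weight_residues: "finite (range (weight_residues r p))"
  unfolding weight_residues_def by (rule finite_range_mod_list)

lemma expansion_cong:
  assumes c: "1 \<le> c" "c < 3 * 2 ^ r"
    and N: "residue_vector (3 * 2 ^ r) p N = residue_vector (3 * 2 ^ r) p N'"
    and k: "weight_residues r p k = weight_residues r p k'"
  shows "2 ^ p dvd (\<Sum>i\<in>{1..<3 * 2 ^ r}. weight r c k i * (2 ^ multiplicity 2 i * basis_coeff r i N))
      - (\<Sum>i\<in>{1..<3 * 2 ^ r}. weight r c k' i * (2 ^ multiplicity 2 i * basis_coeff r i N'))"
    (is "_ dvd ?A - ?C")
proof -
  let ?m = "3 * 2 ^ r :: nat"
  let ?B = "\<Sum>i\<in>{1..<3 * 2 ^ r}. weight r c k' i * (2 ^ multiplicity 2 i * basis_coeff r i N)"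
  have "2 ^ p dvd ?A - ?B"
    using sum_mult_cong[of "{1..<3 * 2 ^ r}" "2 ^ p" "weight r c k" "weight r c k'"
        "\<lambda>i. 2 ^ multiplicity 2 i * basis_coeff r i N"]
      k[unfolded weight_residues_eq_iff] c by (simp add: mult.commute)
  moreover have "2 ^ p dvd ?B - ?C"
  proof (intro sum_mult_cong)
    fix i assume i: "i \<in> {1..<?m}"
    have "2 ^ p dvd basis_coeff r i N - basis_coeff r i N'"
      unfolding basis_coeff_def
      by (rule residue_vector_combination[OF _ N], rule fps_X_one_minus_power_nth_eq_0) (use i in auto)
    thus "2 ^ p dvd 2 ^ multiplicity 2 i * basis_coeff r i N - 2 ^ multiplicity 2 i * basis_coeff r i N'"
      by (simp only: right_diff_distrib[symmetric] dvd_mult)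
  qed
  ultimately have "2 ^ p dvd (?A - ?B) + (?B - ?C)" by (rule dvd_add)
  thus ?thesis by simp
qed

text \<open>The prefactor times \<open>t_m(n)\<close> is \<open>2 ^ k * ?y\<close> with
  \<open>?y\<close> odd, and odd parts are multiplicative.\<close>

lemma signed_odd_part_expansion:
  assumes r: "r \<ge> 2" and c: "1 \<le> c" "c < 3 * 2 ^ r" and dvd: "2 ^ (r + 2) dvd n + c"
  shows "signed_odd_part (int (c * ((3 * 2 ^ r - 1) choose c))) *
      signed_odd_part (thue_morse_power_coeff (3 * 2 ^ r) n)
    = (\<Sum>i\<in>{1..<3 * 2 ^ r}. weight r c (multiplicity 2 (n + c)) i *
        (2 ^ multiplicity 2 i * basis_coeff r i ((n + c) div 2 ^ multiplicity 2 (n + c))))"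
    (is "_ = ?y")
proof -
  let ?k = "multiplicity 2 (n + c)" and ?\<kappa> = "int (c * ((3 * 2 ^ r - 1) choose c))"
  have odd: "odd ?y"
  proof (rule odd_expansion[OF r c])
    show "odd ((n + c) div 2 ^ ?k)" using c by (intro odd_div_multiplicity) simp
    show "r + 2 \<le> ?k" by (rule two_power_dvd_iff[THEN iffD1, OF _ dvd]) (use c in simp)
  qed
  have "thue_morse_power_coeff (3 * 2 ^ r) n = (fps_X ^ c * thue_morse_fps ^ (3 * 2 ^ r)) $ (n + c)"
    by (simp add: thue_morse_power_coeff_def fps_X_power_mult_nth)
  hence eq: "?\<kappa> * thue_morse_power_coeff (3 * 2 ^ r) n = 2 ^ ?k * ?y"
    using coeff_basis_expansion[OF _ c, of ?k "(n + c) div 2 ^ ?k"] r unfolding times_odd_part by simp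
  show ?thesis
    unfolding signed_odd_part_mult[symmetric] eq by (rule signed_odd_part_eq[OF odd])
qed

theorem theorem1p3:
  fixes r s m :: nat
  assumes "r \<ge> 2" and "m = 3 * 2 ^ r" and "s \<ge> 1"
  shows "two_automatic (\<lambda>n. signed_odd_part (thue_morse_power_coeff m n) mod 2 ^ s)"
proof -
  \<comment> \<open>The extra \<open>Suc r\<close> binary digits are what
    \<open>signed_odd_part_cong\<close> requires when the valuation is below
    \<open>Suc r\<close>.\<close>
  define p where "p = s + Suc r"
  define \<Phi> where "\<Phi> n = (residue_vector m p n, if n = 0 then None
      else Some (residue_vector m p (n div 2 ^ multiplicity 2 n), weight_residues r p (multiplicity 2 n)))"
    for n :: nat
  \<comment> \<open>The residue decides which case holds and for which \<open>c\<close>; the list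
    supplies the data at \<open>n + c\<close>.\<close>
  define \<Psi> where "\<Psi> n = (n mod 2 ^ (r + 2), map (\<lambda>c. \<Phi> (n + c)) [0..<Suc m])" for n :: nat
  have "digit_congruent \<Phi>"
    unfolding \<Phi>_def
    by (intro digit_congruent_odd_part digit_congruent_residue_vector finite_range_weight_residues
        weight_residues_Suc)
  hence "digit_congruent \<Psi>"
    unfolding \<Psi>_def by (intro digit_congruent_Pair digit_congruent_mod digit_congruent_shifts) (auto simp: assms)
  thus ?thesis
  proof (rule two_automatic_if_digit_congruent)
    fix n n' assume eq: "\<Psi> n = \<Psi> n'"
    hence shift: "\<Phi> (n + c) = \<Phi> (n' + c)" if "c \<le> m" for c
      using that unfolding \<Psi>_def by (auto simp del: upt_Suc)
    have dvd_iff: "2 ^ (r + 2) dvd n + c \<longleftrightarrow> 2 ^ (r + 2) dvd n' + c" for c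
    proof -
      have "n mod 2 ^ (r + 2) = n' mod 2 ^ (r + 2)" using eq unfolding \<Psi>_def by (simp only: prod.inject)
      hence "(n + c) mod 2 ^ (r + 2) = (n' + c) mod 2 ^ (r + 2)" by (rule mod_add_cong[OF _ refl])
      thus ?thesis by (simp only: dvd_eq_mod_eq_0)
    qed
    let ?t = "thue_morse_power_coeff m"
    have "2 ^ s dvd signed_odd_part (?t n) - signed_odd_part (?t n')"
    proof (cases "\<exists>c. 1 \<le> c \<and> c < m \<and> 2 ^ (r + 2) dvd n + c")
      case True
      then obtain c where c: "1 \<le> c" "c < 3 * 2 ^ r" "2 ^ (r + 2) dvd n + c"
        using assms by blast
      let ?\<kappa> = "int (c * ((3 * 2 ^ r - 1) choose c))"
      have "2 ^ p dvd signed_odd_part ?\<kappa> * signed_odd_part (?t n) - signed_odd_part ?\<kappa> * signed_odd_part (?t n')"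
        unfolding assms(2) signed_odd_part_expansion[OF assms(1) c]
          signed_odd_part_expansion[OF assms(1) c(1,2) c(3)[unfolded dvd_iff]]
        by (rule expansion_cong) (use shift[of c] c assms(2) in \<open>auto simp: \<Phi>_def\<close>)
      hence "2 ^ p dvd signed_odd_part ?\<kappa> * (signed_odd_part (?t n) - signed_odd_part (?t n'))"
        by (simp only: right_diff_distrib)
      \<comment> \<open>This factor depends on \<open>c\<close> alone, and being odd it cancels
        modulo \<open>2 ^ p\<close>.\<close>
      moreover have "odd (signed_odd_part ?\<kappa>)"
      proof -
        have "c \<le> 3 * 2 ^ r - 1" using c(2) by linarith
        hence "?\<kappa> \<noteq> 0" using c(1) by simp
        thus ?thesis by (rule signed_odd_part_cases) simp
      qed
      hence "coprime (2 ^ p) (signed_odd_part ?\<kappa>)"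
        by (simp add: coprime_power_left_iff)
      ultimately have "2 ^ p dvd signed_odd_part (?t n) - signed_odd_part (?t n')"
        by (simp add: coprime_dvd_mult_right_iff)
      thus ?thesis unfolding p_def by (meson le_add1 power_le_dvd)
    next
      case False
      hence "\<not> 2 ^ Suc r dvd ?t n"
        unfolding assms(2) by (intro not_dvd_thue_morse_power_coeff) auto
      moreover have "2 ^ p dvd ?t n - ?t n'"
        using shift[of 0] assms(2) unfolding \<Phi>_def thue_morse_power_coeff_def
        by (auto simp: residue_vector_eq_iff dest: spec[of _ 0])
      ultimately show ?thesis
        unfolding p_def by (intro signed_odd_part_cong)
    qed
    thus "signed_odd_part (?t n) mod 2 ^ s = signed_odd_part (?t n') mod 2 ^ s"
      by (simp add: mod_eq_dvd_iff)
  qed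
qed

end
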